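(* Suppose LTE uses listen-before-talk with random back-off with contention window $[a,b]=[0,1]$, i.e. all AP timers $t_i^W$ and all eNB timers $t_k^L$ are uniform on $[0,1]$, and the medium access indicators of AP $x_i$ and eNB $y_k$ are $$e_i^W=\prod_{x_j\in\Phi_W\setminus\{x_i\}}\Bigl(\mathbf 1_{\{t_j^W\ge t_i^W\}}+\mathbf 1_{\{t_j^W<t_i^W\}}\mathbf 1_{\{G^W_{j,i}/l(\|x_j-x_i\|)\le\Gamma_{cs}/P_W\}}\Bigr)\prod_{y_m\in\Phi_L}\Bigl(\mathbf 1_{\{t_m^L\ge t_i^W\}}+\mathbf 1_{\{t_m^L<t_i^W\}}\mathbf 1_{\{G^{LW}_{m,i}/l(\|y_m-x_i\|)\le\Gamma_{ed}/P_L\}}\Bigr),$$ $$e_k^L=\prod_{x_j\in\Phi_W}\Bigl(\mathbf 1_{\{t_j^W\ge t_k^L\}}+\mathbf 1_{\{t_j^W<t_k^L\}}\mathbf 1_{\{G^{WL}_{j,k}/l(\|x_j-y_k\|)\le\Gamma^L/P_W\}}\Bigr)\prod_{y_m\in\Phi_L\setminus\{y_k\}}\Bigl(\mathbf 1_{\{t_m^L\ge t_k^L\}}+\mathbf 1_{\{t_m^L<t_k^L\}}\mathbf 1_{\{G^{L}_{m,k}/l(\|y_m-y_k\|)\le\Gamma^L/P_L\}}\Bigr).$$ Let $x_0$ (the tagged AP) and $y_0$ (the tagged eNB) be the points of $\Phi_W$ and of $\Phi_L$, respectively, closest to the origin. Then their medium access probabilities are $$\mathbb E(e_0^W)=\int_0^\infty\frac{1-\exp(-N_2^W(r_0)-N^L)}{N_2^W(r_0)+N^L}f_W(r_0)\,dr_0,$$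 $$\mathbb E(e_0^L)=\int_0^\infty\frac{1-\exp(-N_3^W(\Gamma^L)-N_1^L(r_0,\Gamma^L))}{N_3^W(\Gamma^L)+N_1^L(r_0,\Gamma^L)}f_L(r_0)\,dr_0.$$
   Context: Wi-Fi access points (APs) form a homogeneous Poisson point process $\Phi_W=\{x_i\}$ on $\mathbb R^2$ with intensity $\lambda_W>0$; LTE base stations (eNBs) form an independent homogeneous Poisson point process $\Phi_L=\{y_k\}$ on $\mathbb R^2$ with intensity $\lambda_L>0$. Transmit powers are $P_W,P_L>0$. The path loss is $l(d)=(4\pi/\lambda_c)^2 d^{\alpha}$ with wavelength $\lambda_c>0$ and path loss exponent $\alpha>0$. $\Gamma_{cs},\Gamma_{ed}>0$ are Wi-Fi's carrier sensing and energy detection thresholds, $\Gamma^L>0$ is the LTE sensing threshold. $G^W_{j,i},G^{LW}_{m,i},G^{WL}_{j,k},G^L_{m,k}$ are the fadings from AP $x_j$ to AP $x_i$, eNB $y_m$ to AP $x_i$, AP $x_j$ to eNB $y_k$, eNB $y_m$ to eNB $y_k$; all fading variables are i.i.d. exponential with $\mathbb P(G>s)=e^{-\mu s}$, $\mu>0$. The point processes, the timers and the fading variables are all mutually independent. $B(0,r)$ is the closed ball of radius $r$ centred at the origin. Define $$N_2^W(r)=\lambda_W\int_{\mathbb R^2\setminus B(0,r)}\exp\Bigl(-\mu\tfrac{\Gamma_{cs}}{P_W}l(\|x-(r,0)\|)\Bigr)dx,\quad N_1^L(r,\Gamma)=\lambda_L\int_{\mathbb R^2\setminus B(0,r)}\exp\Bigl(-\mu\tfrac{\Gamma}{P_L}l(\|x-(r,0)\|)\Bigr)dx,$$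 $$N^L=\lambda_L\int_{\mathbb R^2}\exp\Bigl(-\mu\tfrac{\Gamma_{ed}}{P_L}l(\|x\|)\Bigr)dx,\quad N_3^W(\Gamma)=\lambda_W\int_{\mathbb R^2}\exp\Bigl(-\mu\tfrac{\Gamma}{P_W}l(\|x\|)\Bigr)dx,$$ $f_W(r)=2\pi\lambda_W r e^{-\lambda_W\pi r^2}$ and $f_L(r)=2\pi\lambda_L r e^{-\lambda_L\pi r^2}$ (the densities of the distances from the origin to the closest AP and closest eNB). *)

theory Defs
  imports "HOL-Probability.Probability"
begin

section \<open>Poisson point processes\<close>

text \<open>
  A point process is given by a measurable enumeration of its points. Points are counted by index,
  i.e. with multiplicity.
\<close>

definition point_count :: "(nat \<Rightarrow> 'a \<Rightarrow> 'b) \<Rightarrow> 'b set \<Rightarrow> 'a \<Rightarrow> nat" where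
  "point_count X A \<omega> = card {i. X i \<omega> \<in> A}"

text \<open>
  Local finiteness is demanded explicitly, because \<^const>\<open>card\<close> is 0 on infinite sets. The formula for the
  distribution also covers null sets, where it reads \<open>0 ^ k / fact k\<close>. Finite families of disjoint
  sets are included in the last conjunct by padding with empty sets.
\<close>

definition homogeneous_poisson_process ::
    "'a measure \<Rightarrow> real \<Rightarrow> (nat \<Rightarrow> 'a \<Rightarrow> 'b::euclidean_space) \<Rightarrow> bool" where
  "homogeneous_poisson_process M lam X \<longleftrightarrow>
     (\<forall>i. X i \<in> borel_measurable M) \<and>
     (\<forall>A\<in>sets borel. bounded A \<longrightarrow>
        (AE \<omega> in M. finite {i. X i \<omega> \<in> A}) \<and>
        (\<forall>k. measure M {\<omega>\<in>space M. point_count X A \<omega> = k} =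
           (lam * measure lborel A) ^ k / fact k * exp (- (lam * measure lborel A)))) \<and>
     (\<forall>A :: nat \<Rightarrow> 'b set. disjoint_family A \<and> (\<forall>n. A n \<in> sets borel \<and> bounded (A n)) \<longrightarrow>
        prob_space.indep_vars M (\<lambda>_. count_space UNIV) (\<lambda>n. point_count X (A n)) UNIV)"

text \<open>
  The index of the point closest to the origin. For a Poisson process ties have probability 0;
  \<open>LEAST\<close> is used instead of a choice operator so that the index depends measurably on the points.
\<close>

definition closest :: "(nat \<Rightarrow> 'a \<Rightarrow> 'b::real_normed_vector) \<Rightarrow> 'a \<Rightarrow> nat" where
  "closest X \<omega> = (LEAST i. \<forall>j. norm (X i \<omega>) \<le> norm (X j \<omega>))"

section \<open>Sources of randomness\<close>

datatype source =
    PointsW | PointsL | TimerW nat | TimerL nat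
  | FadingW nat nat | FadingLW nat nat | FadingWL nat nat | FadingL nat nat

abbreviation generated_events :: "'a measure \<Rightarrow> ('a \<Rightarrow> 'c) \<Rightarrow> 'c measure \<Rightarrow> 'a set set" where
  "generated_events M f N \<equiv> sets (vimage_algebra (space M) f N)"

context
  fixes M :: "'a measure"
    and X Y :: "nat \<Rightarrow> 'a \<Rightarrow> 'b::euclidean_space"
    and tW tL :: "nat \<Rightarrow> 'a \<Rightarrow> real"
    and GW GLW GWL GL :: "nat \<Rightarrow> nat \<Rightarrow> 'a \<Rightarrow> real"
begin

primrec source_events :: "source \<Rightarrow> 'a set set" where
  "source_events PointsW = generated_events M (\<lambda>\<omega> i. X i \<omega>) (Pi\<^sub>M UNIV (\<lambda>_. borel))"
| "source_events PointsL = generated_events M (\<lambda>\<omega> k. Y k \<omega>) (Pi\<^sub>M UNIV (\<lambda>_. borel))"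
| "source_events (TimerW i) = generated_events M (tW i) borel"
| "source_events (TimerL k) = generated_events M (tL k) borel"
| "source_events (FadingW j i) = generated_events M (GW j i) borel"
| "source_events (FadingLW m i) = generated_events M (GLW m i) borel"
| "source_events (FadingWL j k) = generated_events M (GWL j k) borel"
| "source_events (FadingL m k) = generated_events M (GL m k) borel"

end

section \<open>Medium access\<close>

definition path_loss :: "real \<Rightarrow> real \<Rightarrow> real \<Rightarrow> real" where
  "path_loss lam\<^sub>c \<alpha> d = (4 * pi / lam\<^sub>c)\<^sup>2 * d powr \<alpha>"

text \<open>
  The infinite product as limit of its partial products. The library's \<^const>\<open>prodinf\<close> does not provide it
  here, as its convergence notion excludes limit 0 unless caused by finitely many zero factors. For
  factors in \<open>[0,1]\<close>, the limit below always exists and does not depend on the order of the factors.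
\<close>

definition index_prod :: "nat set \<Rightarrow> (nat \<Rightarrow> real) \<Rightarrow> real" where
  "index_prod I f = lim (\<lambda>n. \<Prod>j\<in>I \<inter> {..<n}. f j)"

text \<open>
  The factor contributed by a transmitter with timer \<open>s\<close>, fading \<open>g\<close> and path loss \<open>d\<close> towards a
  device with timer \<open>t\<close>, where \<open>\<theta>\<close> is the quotient of sensing threshold and transmit power.
\<close>

definition access_factor :: "real \<Rightarrow> real \<Rightarrow> real \<Rightarrow> real \<Rightarrow> real \<Rightarrow> real" where
  "access_factor s t g d \<theta> = of_bool (s \<ge> t) + of_bool (s < t) * of_bool (g / d \<le> \<theta>)"

definition access_W where
  "access_W X Y tW tL GW GLW l P\<^sub>W P\<^sub>L \<Gamma>\<^sub>c\<^sub>s \<Gamma>\<^sub>e\<^sub>d i \<omega> =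
     index_prod (UNIV - {i}) (\<lambda>j. access_factor (tW j \<omega>) (tW i \<omega>)
       (GW j i \<omega>) (l (norm (X j \<omega> - X i \<omega>))) (\<Gamma>\<^sub>c\<^sub>s / P\<^sub>W)) *
     index_prod UNIV (\<lambda>m. access_factor (tL m \<omega>) (tW i \<omega>)
       (GLW m i \<omega>) (l (norm (Y m \<omega> - X i \<omega>))) (\<Gamma>\<^sub>e\<^sub>d / P\<^sub>L))"

definition access_L where
  "access_L X Y tW tL GWL GL l P\<^sub>W P\<^sub>L \<Gamma>\<^sub>L k \<omega> =
     index_prod UNIV (\<lambda>j. access_factor (tW j \<omega>) (tL k \<omega>)
       (GWL j k \<omega>) (l (norm (X j \<omega> - Y k \<omega>))) (\<Gamma>\<^sub>L / P\<^sub>W)) *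
     index_prod (UNIV - {k}) (\<lambda>m. access_factor (tL m \<omega>) (tL k \<omega>)
       (GL m k \<omega>) (l (norm (Y m \<omega> - Y k \<omega>))) (\<Gamma>\<^sub>L / P\<^sub>L))"

section \<open>Contention functionals\<close>

definition N2W :: "real \<Rightarrow> real \<Rightarrow> (real \<Rightarrow> real) \<Rightarrow> real \<Rightarrow> real \<Rightarrow> real \<Rightarrow> real" where
  "N2W lam\<^sub>W \<mu> l P\<^sub>W \<Gamma>\<^sub>c\<^sub>s r = lam\<^sub>W *
     (LINT x : UNIV - cball 0 r | lborel. exp (- (\<mu> * (\<Gamma>\<^sub>c\<^sub>s / P\<^sub>W) * l (norm (x - (vector [r, 0] :: real^2))))))"

definition N1L :: "real \<Rightarrow> real \<Rightarrow> (real \<Rightarrow> real) \<Rightarrow> real \<Rightarrow> real \<Rightarrow> real \<Rightarrow> real" where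
  "N1L lam\<^sub>L \<mu> l P\<^sub>L r \<Gamma> = lam\<^sub>L *
     (LINT x : UNIV - cball 0 r | lborel. exp (- (\<mu> * (\<Gamma> / P\<^sub>L) * l (norm (x - (vector [r, 0] :: real^2))))))"

definition NL :: "real \<Rightarrow> real \<Rightarrow> (real \<Rightarrow> real) \<Rightarrow> real \<Rightarrow> real \<Rightarrow> real" where
  "NL lam\<^sub>L \<mu> l P\<^sub>L \<Gamma>\<^sub>e\<^sub>d = lam\<^sub>L *
     (LINT x | lborel. exp (- (\<mu> * (\<Gamma>\<^sub>e\<^sub>d / P\<^sub>L) * l (norm (x :: real^2)))))"

definition N3W :: "real \<Rightarrow> real \<Rightarrow> (real \<Rightarrow> real) \<Rightarrow> real \<Rightarrow> real \<Rightarrow> real" where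
  "N3W lam\<^sub>W \<mu> l P\<^sub>W \<Gamma> = lam\<^sub>W *
     (LINT x | lborel. exp (- (\<mu> * (\<Gamma> / P\<^sub>W) * l (norm (x :: real^2)))))"

text \<open>The density of the distance from the origin to the closest point.\<close>

definition closest_distance_density :: "real \<Rightarrow> real \<Rightarrow> real" where
  "closest_distance_density lam r = 2 * pi * lam * r * exp (- (lam * pi * r\<^sup>2))"

end

theory Submission
  imports Defs "HOL-Real_Asymp.Real_Asymp"
begin

text \<open>
  Conditionally on both point processes and on the timer \<open>t\<close> of the tagged device, the access factors are
  independent, and a transmitter at displacement \<open>z\<close> contributes the mean factor \<open>1 - t p(z)\<close>, where
  \<open>p(z) = exp (- \<mu> \<theta> l(\<parallel>z\<parallel>))\<close>. The factors of the other network average to \<open>exp (- t N)\<close> by the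
  generating functional of a Poisson process and translation invariance. For the own network one needs the
  closest point jointly with the remaining points. Put \<open>w(x, y) = 1\<close> if \<open>\<parallel>y\<parallel> \<le> \<parallel>x\<parallel>\<close> and
  \<open>w(x, y) = t p(y - x)\<close> otherwise. In \<open>\<Sum>x. \<Prod>y \<noteq> x. 1 - w(x, y)\<close> only the closest point \<open>x\<close> contributes, and by
  Mecke's formula the expectation of this sum is \<open>\<lambda> \<integral> exp (- \<lambda> \<integral> w(x, y) dy) dx\<close>. This instance of the formula is
  obtained by replacing \<open>x\<close> by a simple function of \<open>x\<close>, which leaves only independent Poisson counts.
  Polar coordinates and integration over \<open>t \<in> [0,1]\<close> give the result. The second formula is the first one with
  the two networks interchanged.
\<close>

section \<open>Products over index sets\<close>

text \<open>The definition of a Poisson process gives only the laws of counts in bounded Borel sets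
  and their independence on disjoint sets; it says nothing about how \<open>X\<close> orders its
  points. Every expectation over the points is therefore traced back to such counts. The tagged
  index is random, while timers and fadings are attached to indices. Hence the points are frozen
  before the marks: \<open>closest X \<omega>\<close> then is a fixed index and its marks are
  ordinary variables. Two discontinuities shape the limit arguments. The weight \<open>w\<close>
  jumps across the sphere \<open>norm y = norm x\<close>, so ties among the points have to be
  excluded before Mecke's formula, again by counts alone. And \<open>p\<close> jumps at 0, because
  division by 0 yields 0; continuity is demanded only away from 0, which suffices since the other
  points are strictly farther out than the tagged one. Infinite products may have the value 0. They
  are controlled by the monotonicity of partial products with factors in [0,1] and by dominated
  convergence.\<close>

lemma index_prod_tendsto:
  assumes "\<And>j. j \<in> I \<Longrightarrow> f j \<in> {0..1}"
  shows "(\<lambda>n. \<Prod>j\<in>I \<inter> {..<n}. f j) \<longlonglongrightarrow> index_prod I f"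
proof -
  have "decseq (\<lambda>n. \<Prod>j\<in>I \<inter> {..<n}. f j)"
  proof (rule decseq_SucI)
    fix n
    have "I \<inter> {..<Suc n} = (if n \<in> I then insert n (I \<inter> {..<n}) else I \<inter> {..<n})"
      by (auto simp: less_Suc_eq)
    moreover have "0 \<le> (\<Prod>j\<in>I \<inter> {..<n}. f j)"
      using assms by (intro prod_nonneg) auto
    ultimately show "(\<Prod>j\<in>I \<inter> {..<Suc n}. f j) \<le> (\<Prod>j\<in>I \<inter> {..<n}. f j)"
      using assms[of n] by (auto intro: mult_left_le_one_le)
  qed
  moreover have "0 \<le> (\<Prod>j\<in>I \<inter> {..<n}. f j)" for n
    using assms by (intro prod_nonneg) auto
  ultimately obtain L where "(\<lambda>n. \<Prod>j\<in>I \<inter> {..<n}. f j) \<longlonglongrightarrow> L"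
    using decseq_convergent by blast
  then show ?thesis
    by (simp add: index_prod_def limI)
qed

text \<open>The partial products decrease, so each of them bounds the limit from above; the empty
  one gives the bound 1.\<close>

lemma index_prod_le_partial:
  assumes f: "\<And>j. j \<in> I \<Longrightarrow> f j \<in> {0..1}"
  shows "index_prod I f \<le> (\<Prod>j\<in>I \<inter> {..<n}. f j)"
proof (rule LIMSEQ_le_const2[OF index_prod_tendsto[OF f]])
  have "(\<Prod>j\<in>I \<inter> {..<m}. f j) \<le> (\<Prod>j\<in>I \<inter> {..<n}. f j)" if "m \<ge> n" for m
  proof -
    have *: "I \<inter> {..<m} = (I \<inter> {..<n}) \<union> (I \<inter> {n..<m})" "(I \<inter> {..<n}) \<inter> (I \<inter> {n..<m}) = {}"
      using that by auto
    have "(\<Prod>j\<in>I \<inter> {n..<m}. f j) \<le> 1" "0 \<le> (\<Prod>j\<in>I \<inter> {n..<m}. f j)" "0 \<le> (\<Prod>j\<in>I \<inter> {..<n}. f j)"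
      using f by (auto intro!: prod_le_1 prod_nonneg)
    then show ?thesis
      by (subst *(1), subst prod.union_disjoint) (auto intro: mult_left_le)
  qed
  then show "\<exists>N. \<forall>m\<ge>N. (\<Prod>j\<in>I \<inter> {..<m}. f j) \<le> (\<Prod>j\<in>I \<inter> {..<n}. f j)"
    by blast
qed auto

lemma index_prod_bounds:
  assumes f: "\<And>j. j \<in> I \<Longrightarrow> f j \<in> {0..1}"
  shows "index_prod I f \<in> {0..1}"
proof -
  have "0 \<le> index_prod I f"
    using f by (intro LIMSEQ_le_const[OF index_prod_tendsto[OF f]]) (auto intro!: prod_nonneg)
  with index_prod_le_partial[of I f 0, OF f] show ?thesis
    by auto
qed

lemma index_prod_mono:
  assumes "\<And>j. j \<in> I \<Longrightarrow> f j \<in> {0..1}" "\<And>j. j \<in> I \<Longrightarrow> g j \<in> {0..1}" "\<And>j. j \<in> I \<Longrightarrow> f j \<le> g j"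
  shows "index_prod I f \<le> index_prod I g"
  using assms
  by (intro LIMSEQ_le[OF index_prod_tendsto index_prod_tendsto]) (auto intro!: prod_mono)

lemma index_prod_finite:
  assumes "finite S" "S \<subseteq> I" "\<And>j. j \<in> I - S \<Longrightarrow> f j = 1"
  shows "index_prod I f = prod f S"
proof -
  obtain N where N: "S \<subseteq> {..<N}"
    using assms(1) finite_nat_bounded by blast
  have "eventually (\<lambda>n. (\<Prod>j\<in>I \<inter> {..<n}. f j) = prod f S) sequentially"
    using eventually_ge_at_top[of N]
  proof eventually_elim
    case (elim n)
    with N assms(2) have "S \<subseteq> I \<inter> {..<n}" by auto
    then show ?case
      using assms by (intro prod.mono_neutral_right) auto
  qed
  then show ?thesis
    unfolding index_prod_def by (intro limI tendsto_eventually)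
qed

text \<open>A truncated product dominates the full one, and once all factors with index below
  \<open>m\<close> are restored it is at most the partial product up to \<open>m\<close>, which is
  close to the limit. The argument covers the limit 0 as well.\<close>

lemma index_prod_truncate_tendsto:
  assumes f: "\<And>j. j \<in> I \<Longrightarrow> f j \<in> {0..1}"
    and ev: "\<And>j. j \<in> I \<Longrightarrow> eventually (\<lambda>n. P n j) sequentially"
  shows "(\<lambda>n. index_prod I (\<lambda>j. if P n j then f j else 1)) \<longlonglongrightarrow> index_prod I f"
proof (rule order_tendstoI)
  have f': "(if P n j then f j else 1) \<in> {0..1}" if "j \<in> I" for j n
    using f[OF that] by auto
  fix a
  {
    assume "a < index_prod I f"
    moreover have "index_prod I f \<le> index_prod I (\<lambda>j. if P n j then f j else 1)" for n
      using f f' by (intro index_prod_mono) auto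
    ultimately show "eventually (\<lambda>n. a < index_prod I (\<lambda>j. if P n j then f j else 1)) sequentially"
      by (meson always_eventually less_le_trans)
  next
    assume "index_prod I f < a"
    with index_prod_tendsto[of I f] f
    have "eventually (\<lambda>m. (\<Prod>j\<in>I \<inter> {..<m}. f j) < a) sequentially"
      by (blast dest: order_tendstoD(2))
    then obtain m where m: "(\<Prod>j\<in>I \<inter> {..<m}. f j) < a"
      by (blast dest: eventually_happens'[OF sequentially_bot])
    have "eventually (\<lambda>n. \<forall>j\<in>I \<inter> {..<m}. P n j) sequentially"
      using ev by (intro eventually_ball_finite) auto
    then show "eventually (\<lambda>n. index_prod I (\<lambda>j. if P n j then f j else 1) < a) sequentially"
    proof eventually_elim
      case (elim n)
      have "index_prod I (\<lambda>j. if P n j then f j else 1) \<le> (\<Prod>j\<in>I \<inter> {..<m}. if P n j then f j else 1)"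
        using f' by (rule index_prod_le_partial)
      also have "\<dots> = (\<Prod>j\<in>I \<inter> {..<m}. f j)"
        using elim by (intro prod.cong) auto
      finally show ?case
        using m by simp
    qed
  }
qed

lemma borel_measurable_index_prod [measurable (raw)]:
  assumes "\<And>j. f j \<in> borel_measurable N"
  shows "(\<lambda>x. index_prod I (\<lambda>j. f j x)) \<in> borel_measurable N"
  using assms unfolding index_prod_def by measurable

lemma measurable_closest [measurable (raw)]:
  assumes [measurable]: "\<And>i. X i \<in> borel_measurable N"
  shows "(\<lambda>\<omega>. closest X \<omega>) \<in> N \<rightarrow>\<^sub>M count_space UNIV"
  unfolding closest_def by measurable

section \<open>Poisson processes and their closest point\<close>

locale poisson_points = prob_space M
  for M :: "'a measure" +
  fixes lam :: real and X :: "nat \<Rightarrow> 'a \<Rightarrow> 'b::euclidean_space"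
  assumes lam_pos: "lam > 0"
    and poisson: "homogeneous_poisson_process M lam X"
begin

lemma measurable_point [measurable]: "X i \<in> borel_measurable M"
  using poisson by (simp add: homogeneous_poisson_process_def)

lemma AE_finite_points:
  assumes "A \<in> sets borel" "bounded A"
  shows "AE \<omega> in M. finite {i. X i \<omega> \<in> A}"
  using poisson assms by (simp add: homogeneous_poisson_process_def)

text \<open>Integer radii need only countably many null sets and dominate all other radii.\<close>

lemma AE_locally_finite: "AE \<omega> in M. \<forall>R. finite {i. norm (X i \<omega>) \<le> R}"
proof -
  have "AE \<omega> in M. \<forall>n::nat. finite {i. X i \<omega> \<in> cball 0 (real n)}"
    unfolding AE_all_countable by (intro allI AE_finite_points) auto
  then show ?thesis
  proof eventually_elim
    case (elim \<omega>)
    show ?case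
    proof
      fix R :: real
      obtain n :: nat where "R \<le> n"
        using real_arch_simple by blast
      then have "{i. norm (X i \<omega>) \<le> R} \<subseteq> {i. X i \<omega> \<in> cball 0 (real n)}"
        by auto
      with elim show "finite {i. norm (X i \<omega>) \<le> R}"
        using finite_subset by blast
    qed
  qed
qed

lemma indep_point_counts:
  assumes "disjoint_family A" "\<And>n. A n \<in> sets borel" "\<And>n. bounded (A n)"
  shows "indep_vars (\<lambda>_. count_space UNIV) (\<lambda>n. point_count X (A n)) (UNIV :: nat set)"
  using poisson assms unfolding homogeneous_poisson_process_def by blast

text \<open>Measurability of counts is contained in \<open>indep_vars\<close>; the disjoint sequence
  \<open>A, {}, {}, ...\<close> extracts it for a single set.\<close>

lemma measurable_point_count [measurable]:
  assumes "A \<in> sets borel" "bounded A"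
  shows "point_count X A \<in> M \<rightarrow>\<^sub>M count_space UNIV"
proof -
  have "indep_vars (\<lambda>_. count_space UNIV) (\<lambda>n. point_count X (if n = 0 then A else {})) (UNIV :: nat set)"
    using assms by (intro indep_point_counts) (auto simp: disjoint_family_on_def)
  then have "\<forall>n. point_count X (if n = (0::nat) then A else {}) \<in> M \<rightarrow>\<^sub>M count_space UNIV"
    by (simp add: indep_vars_def2)
  from this[rule_format, of 0] show ?thesis
    by simp
qed

section \<open>Expectations of Poisson counts and the generating functional\<close>

lemma has_bochner_integral_point_count:
  fixes g :: "nat \<Rightarrow> real"
  assumes A: "A \<in> sets borel" "bounded A" and g: "\<And>k. 0 \<le> g k"
    and s: "(\<lambda>k. g k * ((lam * measure lborel A) ^ k / fact k * exp (- (lam * measure lborel A)))) sums s"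
  shows "has_bochner_integral M (\<lambda>\<omega>. g (point_count X A \<omega>)) s"
proof (rule has_bochner_integral_nn_integral)
  let ?N = "point_count X A"
  let ?p = "\<lambda>k. (lam * measure lborel A) ^ k / fact k * exp (- (lam * measure lborel A))"
  note [measurable] = measurable_point_count[OF A]
  have p: "prob {\<omega>\<in>space M. ?N \<omega> = k} = ?p k" for k
    using poisson A by (simp add: homogeneous_poisson_process_def)
  have p_nonneg: "0 \<le> ?p k" for k
    using lam_pos by simp
  show "(\<lambda>\<omega>. g (?N \<omega>)) \<in> borel_measurable M"
    by measurable
  show "0 \<le> s"
    by (rule sums_le[OF _ sums_zero s]) (rule mult_nonneg_nonneg[OF g p_nonneg])
  have "(\<integral>\<^sup>+\<omega>. ennreal (g (?N \<omega>)) \<partial>M) =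
      (\<integral>\<^sup>+\<omega>. (\<Sum>k. ennreal (g k) * indicator {\<omega>\<in>space M. ?N \<omega> = k} \<omega>) \<partial>M)"
  proof (rule nn_integral_cong)
    fix \<omega> assume "\<omega> \<in> space M"
    then show "ennreal (g (?N \<omega>)) = (\<Sum>k. ennreal (g k) * indicator {\<omega>\<in>space M. ?N \<omega> = k} \<omega>)"
      by (subst suminf_finite[of "{?N \<omega>}"]) auto
  qed
  also have "\<dots> = (\<Sum>k. ennreal (g k) * emeasure M {\<omega>\<in>space M. ?N \<omega> = k})"
    by (subst nn_integral_suminf) (auto simp: nn_integral_cmult_indicator)
  also have "\<dots> = (\<Sum>k. ennreal (g k * ?p k))"
    by (simp only: emeasure_eq_measure p ennreal_mult[OF g p_nonneg])
  also have "\<dots> = ennreal s"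
    by (intro suminf_ennreal_eq mult_nonneg_nonneg[OF g p_nonneg] s)
  finally show "(\<integral>\<^sup>+\<omega>. ennreal (g (?N \<omega>)) \<partial>M) = ennreal s" .
qed (simp add: g)

text \<open>The probability generating function of the Poisson distribution: the exponential series
  at \<open>c * a\<close> times \<open>exp (- a)\<close>, where \<open>a\<close> is the
  mean.\<close>

lemma point_count_generating_function:
  assumes "A \<in> sets borel" "bounded A" "0 \<le> c"
  shows "has_bochner_integral M (\<lambda>\<omega>. c ^ point_count X A \<omega>) (exp (- (lam * measure lborel A * (1 - c))))"
proof (rule has_bochner_integral_point_count[OF assms(1,2)])
  define a where "a = lam * measure lborel A"
  have "(\<lambda>k. (c * a) ^ k /\<^sub>R fact k * exp (- a)) sums (exp (c * a) * exp (- a))"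
    by (intro sums_mult2 exp_converges)
  moreover have "exp (c * a) * exp (- a) = exp (- (a * (1 - c)))"
    by (simp add: exp_add[symmetric] algebra_simps)
  ultimately show "(\<lambda>k. c ^ k * ((lam * measure lborel A) ^ k / fact k * exp (- (lam * measure lborel A))))
      sums exp (- (lam * measure lborel A * (1 - c)))"
    unfolding a_def[symmetric] by (simp add: power_mult_distrib field_simps)
qed (use assms in auto)

lemma expectation_point_count:
  assumes "A \<in> sets borel" "bounded A"
  shows "has_bochner_integral M (\<lambda>\<omega>. real (point_count X A \<omega>)) (lam * measure lborel A)"
proof (rule has_bochner_integral_point_count[OF assms])
  define a where "a = lam * measure lborel A"
  have "(\<lambda>k. a * (a ^ k /\<^sub>R fact k) * exp (- a)) sums (a * exp a * exp (- a))"
    by (intro sums_mult2 sums_mult exp_converges)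
  moreover have "a * (a ^ k /\<^sub>R fact k) * exp (- a) = real (Suc k) * (a ^ Suc k / fact (Suc k) * exp (- a))" for k
    by (simp add: field_simps del: of_nat_Suc)
  moreover have "a * exp a * exp (- a) = a"
    by (simp add: exp_minus)
  ultimately have "(\<lambda>k. real (Suc k) * (a ^ Suc k / fact (Suc k) * exp (- a))) sums a"
    by simp
  \<comment> \<open>The term at index 0 vanishes, so the shifted series has the same sum.\<close>
  then have "(\<lambda>k. real k * (a ^ k / fact k * exp (- a))) sums a"
    by (subst (asm) sums_Suc_iff) simp
  then show "(\<lambda>k. real k * ((lam * measure lborel A) ^ k / fact k * exp (- (lam * measure lborel A))))
      sums (lam * measure lborel A)"
    unfolding a_def .
qed auto

text \<open>Independence of counts is available for sequences of sets, so the finite family is coded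
  by natural numbers: \<open>A\<close> takes position 0, the set with code \<open>m\<close> takes
  position \<open>Suc m\<close>, and empty sets fill the gaps.\<close>

lemma expectation_prod_point_counts:
  fixes g :: "nat \<Rightarrow> real" and B :: "'k \<Rightarrow> 'b set"
  assumes A: "A \<in> sets borel" "bounded A" and g: "integrable M (\<lambda>\<omega>. g (point_count X A \<omega>))"
    and V: "finite V" "disjoint_family_on B V"
    and B: "\<And>k. k \<in> V \<Longrightarrow> B k \<in> sets borel" "\<And>k. k \<in> V \<Longrightarrow> bounded (B k)"
      "\<And>k. k \<in> V \<Longrightarrow> A \<inter> B k = {}"
    and c: "\<And>k. k \<in> V \<Longrightarrow> 0 \<le> c k"
  shows "(\<integral>\<omega>. g (point_count X A \<omega>) * (\<Prod>k\<in>V. c k ^ point_count X (B k) \<omega>) \<partial>M) =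
    (\<integral>\<omega>. g (point_count X A \<omega>) \<partial>M) * (\<Prod>k\<in>V. exp (- (lam * measure lborel (B k) * (1 - c k))))"
proof -
  obtain h :: "'k \<Rightarrow> nat" where h: "inj_on h V"
    using finite_imp_inj_to_nat_seg[OF V(1)] by blast
  define r where "r = inv_into V h"
  have r [simp]: "r (h k) = k" if "k \<in> V" for k
    using h that by (simp add: r_def)
  define F where "F n = (case n of 0 \<Rightarrow> A | Suc m \<Rightarrow> if m \<in> h ` V then B (r m) else {})" for n
  define G where "G n = (case n of 0 \<Rightarrow> g | Suc m \<Rightarrow> \<lambda>i. c (r m) ^ i)" for n
  let ?K = "insert 0 (Suc ` h ` V)"
  have "indep_vars (\<lambda>_. count_space UNIV) (\<lambda>n. point_count X (F n)) UNIV"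
  proof (rule indep_point_counts)
    show "F n \<in> sets borel" "bounded (F n)" for n
      using A B by (auto simp: F_def split: nat.split)
    have F0: "F 0 = A"
      by (simp add: F_def)
    have FSuc: "F (Suc b) = {} \<or> (\<exists>k\<in>V. b = h k \<and> F (Suc b) = B k)" for b
      by (auto simp: F_def)
    have "F m \<inter> F n = {}" if "m < n" for m n
    proof (cases m)
      case 0
      with that obtain b where "n = Suc b"
        by (cases n) auto
      with 0 show ?thesis
        using FSuc[of b] F0 B(3) by auto
    next
      case (Suc a)
      with that obtain b where b: "n = Suc b" "a < b"
        by (cases n) auto
      with Suc show ?thesis
        using FSuc[of a] FSuc[of b] disjoint_family_onD[OF V(2)] by (metis Int_empty_left Int_empty_right less_irrefl)
    qed
    then show "disjoint_family F"
      unfolding disjoint_family_on_def by (metis Int_commute nat_neq_iff)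
  qed
  then have "indep_vars (\<lambda>_. borel) (\<lambda>n. G n \<circ> point_count X (F n)) UNIV"
    by (rule indep_vars_compose) auto
  then have ind: "indep_vars (\<lambda>_. borel) (\<lambda>n \<omega>. G n (point_count X (F n) \<omega>)) ?K"
    by (auto simp: comp_def intro: indep_vars_subset)
  have int: "integrable M (\<lambda>\<omega>. G n (point_count X (F n) \<omega>))" if "n \<in> ?K" for n
    using that g B c
    by (auto simp: F_def G_def intro!: integrable.intros[OF point_count_generating_function])
  have "(\<integral>\<omega>. (\<Prod>n\<in>?K. G n (point_count X (F n) \<omega>)) \<partial>M) = (\<Prod>n\<in>?K. \<integral>\<omega>. G n (point_count X (F n) \<omega>) \<partial>M)"
    using V by (intro indep_vars_lebesgue_integral ind int) auto
  moreover have "(\<Prod>n\<in>?K. G n (point_count X (F n) \<omega>)) =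
      g (point_count X A \<omega>) * (\<Prod>k\<in>V. c k ^ point_count X (B k) \<omega>)" for \<omega>
    using V h by (subst prod.insert) (auto simp: prod.reindex F_def G_def)
  moreover have "(\<Prod>n\<in>?K. \<integral>\<omega>. G n (point_count X (F n) \<omega>) \<partial>M) =
      (\<integral>\<omega>. g (point_count X A \<omega>) \<partial>M) * (\<Prod>k\<in>V. exp (- (lam * measure lborel (B k) * (1 - c k))))"
    using V h B c has_bochner_integral_integral_eq[OF point_count_generating_function]
    by (subst prod.insert) (auto simp: prod.reindex F_def G_def)
  ultimately show ?thesis
    by simp
qed

text \<open>The product over points is regrouped by the values of \<open>v\<close>: the level set of
  \<open>y\<close> contributes \<open>1 - y\<close> to the power of its count, whose mean is
  \<open>exp (- (lam * y * volume))\<close>, and the exponents add up to the integral of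
  \<open>v\<close>. As \<open>v\<close> vanishes on \<open>A\<close>, the count of \<open>A\<close>
  is independent of these counts.\<close>

lemma expectation_count_times_product_simple:
  fixes g :: "nat \<Rightarrow> real"
  assumes A: "A \<in> sets borel" "bounded A" and g: "integrable M (\<lambda>\<omega>. g (point_count X A \<omega>))"
    and v: "simple_function borel v" "\<And>x. v x \<in> {0..1}" "\<And>x. x \<in> A \<Longrightarrow> v x = 0" "\<And>x. norm x > R \<Longrightarrow> v x = 0"
  shows "(\<integral>\<omega>. g (point_count X A \<omega>) * index_prod UNIV (\<lambda>j. 1 - v (X j \<omega>)) \<partial>M) =
    (\<integral>\<omega>. g (point_count X A \<omega>) \<partial>M) * exp (- (lam * (\<integral>x. v x \<partial>lborel)))"
proof -
  \<comment> \<open>The value 0 is left out: its level set is unbounded, and its points contribute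
    the factor 1.\<close>
  define V where "V = range v - {0}"
  have fin: "finite V"
    using v(1) by (simp add: V_def simple_function_def)
  define B where "B y = v -` {y}" for y
  have B_sets: "B y \<in> sets borel" if "y \<in> V" for y
    using v(1) that by (auto simp: simple_function_def B_def V_def)
  have B_sub: "B y \<subseteq> cball 0 R" if "y \<in> V" for y
  proof
    fix x assume "x \<in> B y"
    with that have "v x \<noteq> 0"
      by (auto simp: B_def V_def)
    then show "x \<in> cball 0 R"
      using v(4)[of x] by (cases "norm x > R") auto
  qed
  have B_bdd: "bounded (B y)" if "y \<in> V" for y
    by (rule bounded_subset[OF bounded_cball B_sub[OF that]])
  have V01: "0 \<le> y \<and> y \<le> 1" if "y \<in> V" for y
    using that v(2) by (auto simp: V_def)
  have "AE \<omega> in M. index_prod UNIV (\<lambda>j. 1 - v (X j \<omega>)) = (\<Prod>y\<in>V. (1 - y) ^ point_count X (B y) \<omega>)"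
    using AE_locally_finite
  proof eventually_elim
    case (elim \<omega>)
    define S where "S = {j. v (X j \<omega>) \<noteq> 0}"
    have "S \<subseteq> {i. norm (X i \<omega>) \<le> R}"
      unfolding S_def using v(4) by (intro Collect_mono) (metis not_le)
    with elim have S: "finite S"
      using finite_subset by blast
    have "index_prod UNIV (\<lambda>j. 1 - v (X j \<omega>)) = (\<Prod>j\<in>S. 1 - v (X j \<omega>))"
      using S by (intro index_prod_finite) (auto simp: S_def)
    also have "\<dots> = (\<Prod>y\<in>V. \<Prod>j\<in>{j\<in>S. v (X j \<omega>) = y}. 1 - v (X j \<omega>))"
      using S fin by (intro prod.group[symmetric]) (auto simp: V_def S_def)
    also have "\<dots> = (\<Prod>y\<in>V. (1 - y) ^ point_count X (B y) \<omega>)"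
    proof (rule prod.cong[OF refl])
      fix y assume "y \<in> V"
      then have "{j\<in>S. v (X j \<omega>) = y} = {j. X j \<omega> \<in> B y}"
        by (auto simp: S_def B_def V_def)
      then show "(\<Prod>j\<in>{j\<in>S. v (X j \<omega>) = y}. 1 - v (X j \<omega>)) = (1 - y) ^ point_count X (B y) \<omega>"
        by (simp add: point_count_def B_def)
    qed
    finally show ?case .
  qed
  moreover have [measurable]: "v \<in> borel_measurable borel"
    using v(1) by (rule borel_measurable_simple_function)
  note [measurable] = measurable_point_count[OF A] measurable_point_count[OF B_sets B_bdd]
  ultimately have "(\<integral>\<omega>. g (point_count X A \<omega>) * index_prod UNIV (\<lambda>j. 1 - v (X j \<omega>)) \<partial>M) =
      (\<integral>\<omega>. g (point_count X A \<omega>) * (\<Prod>y\<in>V. (1 - y) ^ point_count X (B y) \<omega>) \<partial>M)"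
    by (intro integral_cong_AE) auto
  also have "\<dots> = (\<integral>\<omega>. g (point_count X A \<omega>) \<partial>M) * (\<Prod>y\<in>V. exp (- (lam * measure lborel (B y) * (1 - (1 - y)))))"
    using A g fin B_sets B_bdd V01 v(3)
    by (intro expectation_prod_point_counts) (auto simp: disjoint_family_on_def B_def V_def)
  also have "(\<Prod>y\<in>V. exp (- (lam * measure lborel (B y) * (1 - (1 - y))))) = exp (- (lam * (\<Sum>y\<in>V. y * measure lborel (B y))))"
    using fin by (simp add: exp_sum[symmetric] sum_negf sum_distrib_left ac_simps)
  also have "(\<Sum>y\<in>V. y * measure lborel (B y)) = (\<integral>x. v x \<partial>lborel)"
  proof -
    have "v x = (\<Sum>y\<in>V. y * indicator (B y) x)" for x
    proof -
      have "(\<Sum>y\<in>V. y * indicator (B y) x) = (\<Sum>y\<in>V. if v x = y then y else 0)"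
        by (intro sum.cong) (auto simp: B_def)
      also have "\<dots> = v x"
        using fin by (simp add: sum.delta V_def)
      finally show ?thesis ..
    qed
    moreover have "integrable lborel (\<lambda>x. y * indicator (B y) x :: real)" if "y \<in> V" for y
      using B_sets[OF that] emeasure_bounded_finite[OF B_bdd[OF that]] by (auto simp: integrable_indicator_iff)
    ultimately show ?thesis
      using B_sets by (simp add: Bochner_Integration.integral_sum)
  qed
  finally show ?thesis .
qed

lemma expectation_count_times_product:
  fixes g :: "nat \<Rightarrow> real"
  assumes A: "A \<in> sets borel" "bounded A" and g: "integrable M (\<lambda>\<omega>. g (point_count X A \<omega>))"
    and v [measurable]: "v \<in> borel_measurable borel"
    and v01: "\<And>x. v x \<in> {0..1}" and v0: "\<And>x. x \<in> A \<Longrightarrow> v x = 0" "\<And>x. norm x > R \<Longrightarrow> v x = 0"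
  shows "(\<integral>\<omega>. g (point_count X A \<omega>) * index_prod UNIV (\<lambda>j. 1 - v (X j \<omega>)) \<partial>M) =
    (\<integral>\<omega>. g (point_count X A \<omega>) \<partial>M) * exp (- (lam * (\<integral>x. v x \<partial>lborel)))"
proof -
  obtain F where F: "\<And>i. simple_function borel (F i)" "\<And>x. (\<lambda>i. F i x) \<longlonglongrightarrow> v x"
    "\<And>i x. dist (F i x) 0 \<le> 2 * dist (v x) 0"
    using borel_measurable_implies_sequence_metric[OF v, of 0] by (auto simp: space_borel)
  \<comment> \<open>Clamping keeps the approximants in [0,1] without changing the limit.\<close>
  define s where "s i x = min 1 (max 0 (F i x))" for i x
  have s_simple: "simple_function borel (s i)" for i
    using simple_function_compose1[OF F(1), of "\<lambda>y. min 1 (max 0 y)" i] by (simp add: s_def[abs_def])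
  have s_lim: "(\<lambda>i. s i x) \<longlonglongrightarrow> v x" for x
  proof -
    have "(\<lambda>i. s i x) \<longlonglongrightarrow> min 1 (max 0 (v x))"
      unfolding s_def by (intro tendsto_intros F)
    then show ?thesis
      using v01[of x] by simp
  qed
  have s01: "s i x \<in> {0..1}" for i x
    by (auto simp: s_def)
  \<comment> \<open>The approximants are bounded by twice the modulus of \<open>v\<close>, so they
    vanish wherever \<open>v\<close> does; the bounded support and the vanishing on \<open>A\<close>
    carry over.\<close>
  have s0: "s i x = 0" if "v x = 0" for i x
    using F(3)[of i x] that by (simp add: s_def)
  note [measurable] = measurable_point_count[OF A] borel_measurable_simple_function[OF s_simple]
  let ?g = "\<lambda>\<omega>. g (point_count X A \<omega>)"
  have bound: "norm (?g \<omega> * index_prod UNIV (\<lambda>j. 1 - w (X j \<omega>))) \<le> norm (?g \<omega>)" if "\<And>x. w x \<in> {0..1}" for w \<omega>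
    using index_prod_bounds[of UNIV "\<lambda>j. 1 - w (X j \<omega>)"] that
    by (auto simp: abs_mult intro!: mult_left_le)
  have "(\<lambda>i. \<integral>\<omega>. ?g \<omega> * index_prod UNIV (\<lambda>j. 1 - s i (X j \<omega>)) \<partial>M) \<longlonglongrightarrow>
      (\<integral>\<omega>. ?g \<omega> * index_prod UNIV (\<lambda>j. 1 - v (X j \<omega>)) \<partial>M)"
  proof (rule integral_dominated_convergence[where w = "\<lambda>\<omega>. norm (?g \<omega>)"])
    show "AE \<omega> in M. (\<lambda>i. ?g \<omega> * index_prod UNIV (\<lambda>j. 1 - s i (X j \<omega>))) \<longlonglongrightarrow>
        ?g \<omega> * index_prod UNIV (\<lambda>j. 1 - v (X j \<omega>))"
      using AE_locally_finite
    proof eventually_elim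
      case (elim \<omega>)
      define S where "S = {j. norm (X j \<omega>) \<le> R}"
      have "index_prod UNIV (\<lambda>j. 1 - w (X j \<omega>)) = (\<Prod>j\<in>S. 1 - w (X j \<omega>))" if "\<And>x. norm x > R \<Longrightarrow> w x = 0" for w
        using elim that by (intro index_prod_finite) (auto simp: S_def)
      then show ?case
        using v0 s0 by (auto intro!: tendsto_intros s_lim)
    qed
    show "AE \<omega> in M. norm (?g \<omega> * index_prod UNIV (\<lambda>j. 1 - s i (X j \<omega>))) \<le> norm (?g \<omega>)" for i
      using bound s01 by auto
  qed (use g in auto)
  moreover have "(\<lambda>i. (\<integral>\<omega>. ?g \<omega> \<partial>M) * exp (- (lam * (\<integral>x. s i x \<partial>lborel)))) \<longlonglongrightarrow>
      (\<integral>\<omega>. ?g \<omega> \<partial>M) * exp (- (lam * (\<integral>x. v x \<partial>lborel)))"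
  proof -
    have "(\<lambda>i. \<integral>x. s i x \<partial>lborel) \<longlonglongrightarrow> (\<integral>x. v x \<partial>lborel)"
    proof (rule integral_dominated_convergence[where w = "indicator (cball 0 R)"])
      show "integrable lborel (indicator (cball 0 R) :: 'b \<Rightarrow> real)"
        using emeasure_bounded_finite[of "cball (0::'b) R"] by (auto simp: integrable_indicator_iff)
      show "AE x in lborel. norm (s i x) \<le> indicator (cball 0 R) x" for i
        using s01[of i] s0 v0(2) by (intro AE_I2) (force simp: indicator_def)
    qed (use s_lim in auto)
    then show ?thesis
      by (intro tendsto_intros)
  qed
  moreover have "(\<integral>\<omega>. ?g \<omega> * index_prod UNIV (\<lambda>j. 1 - s i (X j \<omega>)) \<partial>M) =
      (\<integral>\<omega>. ?g \<omega> \<partial>M) * exp (- (lam * (\<integral>x. s i x \<partial>lborel)))" for i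
    by (rule expectation_count_times_product_simple[OF A g s_simple s01]) (rule s0, erule v0)+
  ultimately show ?thesis
    by (simp add: LIMSEQ_unique)
qed

lemma generating_functional_bounded_support:
  assumes v: "v \<in> borel_measurable borel" "\<And>x. v x \<in> {0..1}" "\<And>x. norm x > R \<Longrightarrow> v x = 0"
  shows "(\<integral>\<omega>. index_prod UNIV (\<lambda>j. 1 - v (X j \<omega>)) \<partial>M) = exp (- (lam * (\<integral>x. v x \<partial>lborel)))"
  using expectation_count_times_product[of "{}" "\<lambda>_. 1" v R] v by (simp add: prob_space)

text \<open>The probability generating functional of the process. Truncating \<open>v\<close> to
  balls gives products that decrease to the full one and integrals dominated by
  \<open>v\<close>.\<close>

lemma generating_functional:
  assumes v: "integrable lborel v" "\<And>x. v x \<in> {0..1}"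
  shows "(\<integral>\<omega>. index_prod UNIV (\<lambda>j. 1 - v (X j \<omega>)) \<partial>M) = exp (- (lam * (\<integral>x. v x \<partial>lborel)))"
proof -
  have [measurable]: "v \<in> borel_measurable borel"
    using borel_measurable_integrable[OF v(1)] by simp
  define w where "w n x = (if norm x \<le> real n then v x else 0)" for n x
  have [measurable]: "w n \<in> borel_measurable borel" for n
    unfolding w_def by measurable
  have w01: "w n x \<in> {0..1}" for n x
    using v(2)[of x] by (simp add: w_def)
  have ev: "eventually (\<lambda>n. r \<le> real n) sequentially" for r
    using filterlim_real_sequentially by (simp add: filterlim_at_top)
  have "(\<lambda>n. \<integral>\<omega>. index_prod UNIV (\<lambda>j. 1 - w n (X j \<omega>)) \<partial>M) \<longlonglongrightarrow> (\<integral>\<omega>. index_prod UNIV (\<lambda>j. 1 - v (X j \<omega>)) \<partial>M)"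
  proof (rule integral_dominated_convergence[where w = "\<lambda>_. 1"])
    show "AE \<omega> in M. (\<lambda>n. index_prod UNIV (\<lambda>j. 1 - w n (X j \<omega>))) \<longlonglongrightarrow> index_prod UNIV (\<lambda>j. 1 - v (X j \<omega>))"
    proof (rule AE_I2)
      fix \<omega>
      have "(\<lambda>n. index_prod UNIV (\<lambda>j. if norm (X j \<omega>) \<le> real n then 1 - v (X j \<omega>) else 1)) \<longlonglongrightarrow>
          index_prod UNIV (\<lambda>j. 1 - v (X j \<omega>))"
        using v(2) ev by (intro index_prod_truncate_tendsto) auto
      then show "(\<lambda>n. index_prod UNIV (\<lambda>j. 1 - w n (X j \<omega>))) \<longlonglongrightarrow> index_prod UNIV (\<lambda>j. 1 - v (X j \<omega>))"
        by (simp add: w_def if_distrib[of "\<lambda>x. 1 - x"] cong: if_cong)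
    qed
    show "AE \<omega> in M. norm (index_prod UNIV (\<lambda>j. 1 - w n (X j \<omega>))) \<le> 1" for n
      using index_prod_bounds[of UNIV "\<lambda>j. 1 - w n (X j _)"] w01 by auto
  qed auto
  moreover have "(\<integral>\<omega>. index_prod UNIV (\<lambda>j. 1 - w n (X j \<omega>)) \<partial>M) = exp (- (lam * (\<integral>x. w n x \<partial>lborel)))" for n
    using w01 by (intro generating_functional_bounded_support[where R = "real n"]) (auto simp: w_def)
  moreover have "(\<lambda>n. exp (- (lam * (\<integral>x. w n x \<partial>lborel)))) \<longlonglongrightarrow> exp (- (lam * (\<integral>x. v x \<partial>lborel)))"
  proof (intro tendsto_intros integral_dominated_convergence[where w = v])
    show "AE x in lborel. (\<lambda>n. w n x) \<longlonglongrightarrow> v x"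
    proof (intro AE_I2 tendsto_eventually)
      show "eventually (\<lambda>n. w n x = v x) sequentially" for x
        using ev[of "norm x"] by eventually_elim (simp add: w_def)
    qed
    show "AE x in lborel. norm (w n x) \<le> v x" for n
      using v(2) by (auto simp: w_def)
  qed (use v in auto)
  ultimately show ?thesis
    using LIMSEQ_unique by simp
qed

section \<open>Absence of ties and existence of a closest point\<close>

lemma prob_two_points_le:
  assumes A: "A \<in> sets borel" "bounded A"
  shows "prob {\<omega>\<in>space M. 2 \<le> point_count X A \<omega>} \<le> (lam * measure lborel A)\<^sup>2"
proof -
  note [measurable] = measurable_point_count[OF A]
  define a where "a = lam * measure lborel A"
  have p: "prob {\<omega>\<in>space M. point_count X A \<omega> = k} = a ^ k / fact k * exp (- a)" for k
    using poisson A by (simp add: homogeneous_poisson_process_def a_def)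
  have "{\<omega>\<in>space M. 2 \<le> point_count X A \<omega>} =
      space M - ({\<omega>\<in>space M. point_count X A \<omega> = 0} \<union> {\<omega>\<in>space M. point_count X A \<omega> = 1})"
    by auto
  then have "prob {\<omega>\<in>space M. 2 \<le> point_count X A \<omega>} =
      1 - prob ({\<omega>\<in>space M. point_count X A \<omega> = 0} \<union> {\<omega>\<in>space M. point_count X A \<omega> = 1})"
    by (simp add: prob_compl)
  also have "prob ({\<omega>\<in>space M. point_count X A \<omega> = 0} \<union> {\<omega>\<in>space M. point_count X A \<omega> = 1}) = exp (- a) + a * exp (- a)"
    using p[of 0] p[of 1] by (subst finite_measure_Union) auto
  also have "1 - (exp (- a) + a * exp (- a)) = 1 - (1 + a) * exp (- a)"
    by (simp add: algebra_simps)
  \<comment> \<open>From \<open>exp (- a) >= 1 - a\<close> the left side is at most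
    \<open>1 - (1 + a) * (1 - a)\<close>. The quadratic order is what beats the number of shells in
    \<open>AE_no_ties\<close>.\<close>
  also have "\<dots> \<le> a\<^sup>2"
  proof -
    have "0 \<le> a"
      using lam_pos by (simp add: a_def)
    then have "(1 + a) * (1 - a) \<le> (1 + a) * exp (- a)"
      using exp_ge_add_one_self[of "- a"] by (intro mult_left_mono) auto
    then show ?thesis
      by (simp add: algebra_simps power2_eq_square)
  qed
  finally show ?thesis
    unfolding a_def .
qed

text \<open>Two points at equal distance from the origin share every spherical shell. If a ball is
  cut into \<open>n\<close> shells of equal volume, a given shell contains two points with
  probability of order \<open>1 / n^2\<close>, so the union bound is of order
  \<open>1 / n\<close>.\<close>

lemma AE_no_ties: "AE \<omega> in M. \<forall>i j. i \<noteq> j \<longrightarrow> norm (X i \<omega>) \<noteq> norm (X j \<omega>)"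
proof -
  define d where "d = DIM('b)"
  have d: "0 < d"
    by (simp add: d_def)
  \<comment> \<open>Volume is linear in the \<open>d\<close>-th power of the radius, hence the bound
    on that power; natural \<open>K\<close> keep the number of null sets countable.\<close>
  have "AE \<omega> in M. \<not> (\<exists>i j. i \<noteq> j \<and> norm (X i \<omega>) = norm (X j \<omega>) \<and> norm (X i \<omega>) ^ d < real K)" for K
  proof -
    define T where "T = {\<omega>\<in>space M. \<exists>i j. i \<noteq> j \<and> norm (X i \<omega>) = norm (X j \<omega>) \<and> norm (X i \<omega>) ^ d < real K}"
    have T [measurable]: "T \<in> sets M"
      unfolding T_def by measurable
    define c where "c = lam * unit_ball_vol (real d) * real K"
    have le: "prob T \<le> c\<^sup>2 / real n" if "n > 0" for n :: nat
    proof -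
      \<comment> \<open>shells of equal volume\<close>
      define r where "r k = root d (real K * real k / real n)" for k
      define S where "S k = ball (0::'b) (r (Suc k)) - ball 0 (r k)" for k
      have r_nonneg: "0 \<le> r k" for k
        using d by (simp add: r_def)
      have r_pow: "r k ^ d = real K * real k / real n" for k
        using d by (simp add: r_def)
      have r_mono: "r k \<le> r (Suc k)" for k
        using d by (auto simp: r_def divide_simps intro!: mult_left_mono)
      have S: "S k \<in> sets borel" "bounded (S k)" for k
        unfolding S_def by (auto intro: bounded_subset[OF bounded_ball])
      have norm_less: "norm x < r k \<longleftrightarrow> norm x ^ d < real K * real k / real n" for x :: 'b and k
        unfolding r_pow[symmetric] not_le[symmetric] using d r_nonneg[of k] by simp
      have "measure lborel (S k) = unit_ball_vol (real d) * real K / real n" for k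
      proof -
        have "measure lborel (S k) = measure lborel (ball (0::'b) (r (Suc k))) - measure lborel (ball (0::'b) (r k))"
          unfolding S_def using emeasure_bounded_finite[of "ball (0::'b) (r (Suc k))"] r_mono[of k]
          by (intro measure_Diff) auto
        then show ?thesis
          using that by (simp add: content_ball r_nonneg r_pow d_def[symmetric]) (simp add: field_simps)
      qed
      then have vol: "lam * measure lborel (S k) = c / real n" for k
        by (simp add: c_def)
      note [measurable] = measurable_point_count[OF S]
      have "AE \<omega> in M. \<omega> \<in> T \<longrightarrow> \<omega> \<in> (\<Union>k<n. {\<omega>\<in>space M. 2 \<le> point_count X (S k) \<omega>})"
        using AE_locally_finite
      proof eventually_elim
        case (elim \<omega>)
        show ?case
        proof
          assume "\<omega> \<in> T"
          then obtain i j where ij: "\<omega> \<in> space M" "i \<noteq> j" "norm (X i \<omega>) = norm (X j \<omega>)" "norm (X i \<omega>) ^ d < real K"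
            by (auto simp: T_def)
          \<comment> \<open>The shell of the tied points: the first one whose outer radius exceeds
            their common norm.\<close>
          define k where "k = (LEAST k. norm (X i \<omega>) < r (Suc k))"
          have "norm (X i \<omega>) < r (Suc (n - 1))"
            using ij that by (subst norm_less) simp
          then have k: "norm (X i \<omega>) < r (Suc k)" "k \<le> n - 1"
            unfolding k_def by (rule LeastI, rule Least_le)
          have "\<not> norm (X i \<omega>) < r k"
          proof (cases k)
            case 0
            then show ?thesis
              by (simp add: r_def)
          next
            case (Suc k')
            then show ?thesis
              using not_less_Least[of k' "\<lambda>k. norm (X i \<omega>) < r (Suc k)"] by (simp add: k_def)
          qed
          with k ij have "{i, j} \<subseteq> {i. X i \<omega> \<in> S k}"
            by (auto simp: S_def)
          moreover have "finite {i. X i \<omega> \<in> S k}"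
            by (rule finite_subset[OF _ elim[rule_format, of "r (Suc k)"]]) (auto simp: S_def)
          ultimately have "card {i, j} \<le> point_count X (S k) \<omega>"
            unfolding point_count_def by (intro card_mono)
          with k ij that show "\<omega> \<in> (\<Union>k<n. {\<omega>\<in>space M. 2 \<le> point_count X (S k) \<omega>})"
            by (intro UN_I[of k]) auto
        qed
      qed
      then have "prob T \<le> prob (\<Union>k<n. {\<omega>\<in>space M. 2 \<le> point_count X (S k) \<omega>})"
        by (intro finite_measure_mono_AE) auto
      also have "\<dots> \<le> (\<Sum>k<n. prob {\<omega>\<in>space M. 2 \<le> point_count X (S k) \<omega>})"
        by (intro finite_measure_subadditive_finite) auto
      also have "\<dots> \<le> (\<Sum>k<n. (c / real n)\<^sup>2)"
        using prob_two_points_le[OF S] unfolding vol by (intro sum_mono)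
      also have "\<dots> = c\<^sup>2 / real n"
        using that by (simp add: power2_eq_square)
      finally show ?thesis .
    qed
    have "prob T \<le> 0"
    proof (rule LIMSEQ_le_const)
      show "(\<lambda>n. c\<^sup>2 / real n) \<longlonglongrightarrow> 0"
        by (rule lim_const_over_n)
      show "\<exists>N. \<forall>n\<ge>N. prob T \<le> c\<^sup>2 / real n"
        using le by (intro exI[of _ 1]) auto
    qed
    then have "prob T = 0"
      by (simp add: measure_le_0_iff)
    then have "AE \<omega> in M. \<omega> \<notin> T"
      by (simp add: prob_eq_0)
    with AE_space show ?thesis
      by eventually_elim (auto simp: T_def)
  qed
  then have "AE \<omega> in M. \<forall>K. \<not> (\<exists>i j. i \<noteq> j \<and> norm (X i \<omega>) = norm (X j \<omega>) \<and> norm (X i \<omega>) ^ d < real K)"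
    unfolding AE_all_countable by blast
  then show ?thesis
  proof eventually_elim
    case (elim \<omega>)
    show ?case
    proof (intro allI impI notI)
      fix i j assume "i \<noteq> j" "norm (X i \<omega>) = norm (X j \<omega>)"
      moreover obtain K :: nat where "norm (X i \<omega>) ^ d < real K"
        using reals_Archimedean2 by blast
      ultimately show False
        using elim by blast
    qed
  qed
qed

text \<open>Local finiteness leaves finitely many candidates at least as close as point 0, so a
  minimizer exists and \<open>LEAST\<close> in \<open>closest\<close> is meaningful; the inequality
  is strict because ties are excluded.\<close>

lemma AE_closest:
  "AE \<omega> in M. \<forall>j. j \<noteq> closest X \<omega> \<longrightarrow> norm (X (closest X \<omega>) \<omega>) < norm (X j \<omega>)"
  using AE_locally_finite AE_no_ties
proof eventually_elim
  case (elim \<omega>)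
  define S where "S = {i. norm (X i \<omega>) \<le> norm (X 0 \<omega>)}"
  have "finite S" "S \<noteq> {}"
    using elim(1) by (auto simp: S_def)
  then obtain i where i: "i \<in> S" "\<And>j. j \<in> S \<Longrightarrow> norm (X i \<omega>) \<le> norm (X j \<omega>)"
    using arg_min_if_finite(1)[of S "\<lambda>i. norm (X i \<omega>)"] arg_min_least[of S _ "\<lambda>i. norm (X i \<omega>)"]
    by blast
  have "norm (X i \<omega>) \<le> norm (X j \<omega>)" for j
    using i(1) i(2)[of j] by (cases "j \<in> S") (auto simp: S_def)
  then have "\<forall>j. norm (X (closest X \<omega>) \<omega>) \<le> norm (X j \<omega>)"
    unfolding closest_def by (rule LeastI[of "\<lambda>i. \<forall>j. norm (X i \<omega>) \<le> norm (X j \<omega>)", OF allI])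
  with elim(2) show ?case
    by (simp add: order_less_le)
qed

text \<open>The cutoff \<open>K\<close> keeps the sum over candidate points finite: the discretized
  sums are bounded by the number of points in the ball, which is integrable, and all weights have
  the bounded support that \<open>expectation_count_times_product\<close> requires. Continuity of
  \<open>p\<close> off 0 serves the limit in which the discretized position returns to
  \<open>x\<close>.\<close>

lemma closest_point_formula_bounded:
  fixes p :: "'b \<Rightarrow> real" and K :: real
  assumes p [measurable]: "p \<in> borel_measurable borel"
    and p01: "\<And>z. p z \<in> {0..1}" and cont: "\<And>z. z \<noteq> 0 \<Longrightarrow> isCont p z"
  defines "w \<equiv> \<lambda>x y. if norm y > K then 0 else if norm y \<le> norm x then 1 else p (y - x)"
  shows "(\<integral>\<omega>. (if norm (X (closest X \<omega>) \<omega>) \<le> K then index_prod (UNIV - {closest X \<omega>})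
        (\<lambda>j. if norm (X j \<omega>) \<le> K then 1 - p (X j \<omega> - X (closest X \<omega>) \<omega>) else 1) else 0) \<partial>M) =
    lam * (\<integral>x. indicator (cball 0 K) x * exp (- (lam * (\<integral>y. w x y \<partial>lborel))) \<partial>lborel)"
proof -
  have w_meas [measurable]: "(\<lambda>(x, y). w x y) \<in> borel_measurable (borel \<Otimes>\<^sub>M borel)"
    unfolding w_def by measurable
  have J_meas: "(\<lambda>x. \<integral>y. w x y \<partial>lborel) \<in> borel_measurable borel"
  proof (rule lborel.borel_measurable_lebesgue_integral)
    show "(\<lambda>(x, y). w x y) \<in> borel_measurable (borel \<Otimes>\<^sub>M lborel)"
      unfolding w_def by measurable
  qed
  have w01: "w x y \<in> {0..1}" for x y
    using p01 by (simp add: w_def)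
  have w0: "w x y = 0" if "norm y > K" for x y
    using that by (simp add: w_def)
  \<comment> \<open>Simple functions approximating the identity: \<open>F n x\<close> is the
    discretized position of \<open>x\<close>.\<close>
  obtain F :: "nat \<Rightarrow> 'b \<Rightarrow> 'b" where F: "\<And>n. simple_function borel (F n)" "\<And>x. (\<lambda>n. F n x) \<longlonglongrightarrow> x"
    using borel_measurable_implies_sequence_metric[of "\<lambda>x::'b. x" borel 0] by auto
  have fin: "finite (range (F n))" for n
    using F(1)[of n] by (simp add: simple_function_def)
  have F_meas [measurable]: "F n \<in> borel_measurable borel" for n
    by (rule borel_measurable_simple_function[OF F(1)])
  define A where "A n c = F n -` {c} \<inter> cball 0 K" for n c
  have A: "A n c \<in> sets borel" "bounded (A n c)" for n c
  proof -
    have "F n -` {c} \<in> sets borel"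
      using measurable_sets[OF F_meas, of "{c}" n] by simp
    then show "A n c \<in> sets borel"
      unfolding A_def by auto
    show "bounded (A n c)"
      unfolding A_def by (rule bounded_subset[OF bounded_cball]) auto
  qed
  \<comment> \<open>Emptying the cell of \<open>c\<close> makes the number of points in it independent of the product.\<close>
  define v where "v n c y = (if F n y = c then 0 else w c y)" for n c y
  have v_meas [measurable]: "v n c \<in> borel_measurable borel" for n c
    unfolding v_def by measurable
  have v01: "v n c y \<in> {0..1}" for n c y
    using w01 by (simp add: v_def)
  have v0: "v n c y = 0" if "norm y > K" for n c y
    using that w0 by (simp add: v_def)
  \<comment> \<open>The emptied cell disappears in the limit, since \<open>F n y\<close> and
    \<open>F n x\<close> differ eventually; the condition on the norms avoids the sphere on which
    \<open>w\<close> jumps.\<close>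
  have v_lim: "(\<lambda>n. v n (F n x) y) \<longlonglongrightarrow> w x y" if "norm x \<noteq> norm y" for x y
  proof -
    have "(\<lambda>n. dist (F n y) (F n x)) \<longlonglongrightarrow> dist y x"
      by (intro tendsto_dist F)
    then have "eventually (\<lambda>n. 0 < dist (F n y) (F n x)) sequentially"
      using that by (intro order_tendstoD(1)) auto
    then have "eventually (\<lambda>n. w (F n x) y = v n (F n x) y) sequentially"
      by eventually_elim (auto simp: v_def)
    moreover have "(\<lambda>n. w (F n x) y) \<longlonglongrightarrow> w x y"
    proof -
      have lim: "(\<lambda>n. norm (F n x)) \<longlonglongrightarrow> norm x"
        by (intro tendsto_norm F)
      consider "norm y > K" | "norm y \<le> K" "norm y < norm x" | "norm y \<le> K" "norm x < norm y"
        using \<open>norm x \<noteq> norm y\<close> by linarith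
      then show ?thesis
      proof cases
        case 1
        then show ?thesis
          by (simp add: w_def)
      next
        case 2
        have "eventually (\<lambda>n. w (F n x) y = w x y) sequentially"
          using order_tendstoD(1)[OF lim 2(2)] by eventually_elim (use 2 in \<open>simp add: w_def\<close>)
        then show ?thesis
          by (rule tendsto_eventually)
      next
        case 3
        have "(\<lambda>n. p (y - F n x)) \<longlonglongrightarrow> p (y - x)"
          using 3 by (intro isCont_tendsto_compose[OF cont] tendsto_intros F) auto
        moreover have "eventually (\<lambda>n. p (y - F n x) = w (F n x) y) sequentially"
          using order_tendstoD(2)[OF lim 3(2)] by eventually_elim (use 3 in \<open>simp add: w_def\<close>)
        moreover have "w x y = p (y - x)"
          using 3 by (simp add: w_def)
        ultimately show ?thesis
          by (simp add: Lim_transform_eventually)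
      qed
    qed
    ultimately show ?thesis
      by (rule Lim_transform_eventually[rotated])
  qed
  \<comment> \<open>\<open>L n\<close> is the Mecke sum with the tagged position replaced by the
    value \<open>c\<close> of its cell; \<open>H n\<close> is the matching integrand on the space
    side.\<close>
  define L where "L n \<omega> = (\<Sum>c\<in>range (F n). real (point_count X (A n c) \<omega>) * index_prod UNIV (\<lambda>j. 1 - v n c (X j \<omega>)))" for n \<omega>
  define H where "H n x = (\<Sum>c\<in>range (F n). indicator (A n c) x * exp (- (lam * (\<integral>y. v n c y \<partial>lborel))))" for n x
  note [measurable] = measurable_point_count[OF A]
  have int_count: "integrable M (\<lambda>\<omega>. real (point_count X (A n c) \<omega>))" for n c
    by (rule integrable.intros[OF expectation_point_count[OF A]])
  have fin_meas: "emeasure lborel (A n c) < \<infinity>" for n c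
    using emeasure_bounded_finite[OF A(2)] .
  have L_meas [measurable]: "L n \<in> borel_measurable M" for n
    unfolding L_def by measurable
  have H_meas [measurable]: "H n \<in> borel_measurable borel" for n
    unfolding H_def using A by measurable
  have bound1: "\<bar>index_prod UNIV (\<lambda>j. 1 - v n c (X j \<omega>))\<bar> \<le> 1" for n c \<omega>
    using index_prod_bounds[of UNIV "\<lambda>j. 1 - v n c (X j \<omega>)"] v01 by auto
  have "(\<integral>\<omega>. L n \<omega> \<partial>M) = lam * (\<integral>x. H n x \<partial>lborel)" for n
  proof -
    have int: "integrable M (\<lambda>\<omega>. real (point_count X (A n c) \<omega>) * index_prod UNIV (\<lambda>j. 1 - v n c (X j \<omega>)))" for c
      using bound1 by (intro Bochner_Integration.integrable_bound[OF int_count[of n c]]) (auto simp: abs_mult intro!: mult_left_le)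
    have "(\<integral>\<omega>. L n \<omega> \<partial>M) =
        (\<Sum>c\<in>range (F n). \<integral>\<omega>. real (point_count X (A n c) \<omega>) * index_prod UNIV (\<lambda>j. 1 - v n c (X j \<omega>)) \<partial>M)"
      unfolding L_def using int by (rule Bochner_Integration.integral_sum)
    also have "\<dots> = (\<Sum>c\<in>range (F n). lam * measure lborel (A n c) * exp (- (lam * (\<integral>y. v n c y \<partial>lborel))))"
    proof (rule sum.cong[OF refl])
      fix c
      show "(\<integral>\<omega>. real (point_count X (A n c) \<omega>) * index_prod UNIV (\<lambda>j. 1 - v n c (X j \<omega>)) \<partial>M) =
          lam * measure lborel (A n c) * exp (- (lam * (\<integral>y. v n c y \<partial>lborel)))"
        unfolding has_bochner_integral_integral_eq[OF expectation_point_count[OF A], symmetric]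
        by (rule expectation_count_times_product[OF A int_count v_meas v01 _ v0]) (auto simp: v_def A_def)
    qed
    also have "\<dots> = lam * (\<Sum>c\<in>range (F n). \<integral>x. indicator (A n c) x * exp (- (lam * (\<integral>y. v n c y \<partial>lborel))) \<partial>lborel)"
      using A by (simp add: sum_distrib_left mult.assoc)
    also have "(\<Sum>c\<in>range (F n). \<integral>x. indicator (A n c) x * exp (- (lam * (\<integral>y. v n c y \<partial>lborel))) \<partial>lborel) = (\<integral>x. H n x \<partial>lborel)"
      unfolding H_def using A fin_meas
      by (intro Bochner_Integration.integral_sum[symmetric] integrable_mult_left) (simp add: integrable_indicator_iff)
    finally show ?thesis .
  qed
  then have "(\<lambda>n. \<integral>\<omega>. L n \<omega> \<partial>M) \<longlonglongrightarrow>
      lam * (\<integral>x. indicator (cball 0 K) x * exp (- (lam * (\<integral>y. w x y \<partial>lborel))) \<partial>lborel)"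
    if "(\<lambda>n. \<integral>x. H n x \<partial>lborel) \<longlonglongrightarrow>
      (\<integral>x. indicator (cball 0 K) x * exp (- (lam * (\<integral>y. w x y \<partial>lborel))) \<partial>lborel)"
    using tendsto_mult_left[OF that, of lam] by simp
  moreover have "(\<lambda>n. \<integral>x. H n x \<partial>lborel) \<longlonglongrightarrow>
      (\<integral>x. indicator (cball 0 K) x * exp (- (lam * (\<integral>y. w x y \<partial>lborel))) \<partial>lborel)"
  proof (rule integral_dominated_convergence[where w = "indicator (cball 0 K)"])
    have H_eq: "H n x = indicator (cball 0 K) x * exp (- (lam * (\<integral>y. v n (F n x) y \<partial>lborel)))" for n x
    proof -
      have "H n x = (\<Sum>c\<in>range (F n). if F n x = c then
          indicator (cball 0 K) x * exp (- (lam * (\<integral>y. v n c y \<partial>lborel))) else 0)"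
        unfolding H_def by (intro sum.cong) (auto simp: A_def indicator_def)
      then show ?thesis
        using fin by simp
    qed
    show int_ball: "integrable lborel (indicator (cball 0 K) :: 'b \<Rightarrow> real)"
      using emeasure_bounded_finite[of "cball (0::'b) K"] by (auto simp: integrable_indicator_iff)
    show "AE x in lborel. (\<lambda>n. H n x) \<longlonglongrightarrow> indicator (cball 0 K) x * exp (- (lam * (\<integral>y. w x y \<partial>lborel)))"
      unfolding H_eq
    proof (rule AE_I2)
      fix x :: 'b
      have "(\<lambda>n. \<integral>y. v n (F n x) y \<partial>lborel) \<longlonglongrightarrow> (\<integral>y. w x y \<partial>lborel)"
      proof (rule integral_dominated_convergence[where w = "indicator (cball 0 K)"])
        \<comment> \<open>The sphere through \<open>x\<close>, where the weights may fail to
          converge, is a null set.\<close>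
        have "sphere (0::'b) (norm x) \<in> null_sets lborel"
          using negligible_sphere[of "0::'b" "norm x"] by (auto simp: negligible_iff_null_sets null_sets_completion_iff)
        then have "AE y in lborel. y \<notin> sphere (0::'b) (norm x)"
          by (rule AE_not_in)
        then show "AE y in lborel. (\<lambda>n. v n (F n x) y) \<longlonglongrightarrow> w x y"
          by eventually_elim (auto intro!: v_lim)
        show "w x \<in> borel_measurable lborel"
          by simp
        show "AE y in lborel. norm (v n (F n x) y) \<le> indicator (cball 0 K) y" for n
          using v01 v0 by (intro AE_I2) (auto simp: indicator_def)
      qed (auto intro: int_ball)
      then show "(\<lambda>n. indicator (cball 0 K) x * exp (- (lam * (\<integral>y. v n (F n x) y \<partial>lborel)))) \<longlonglongrightarrow>
          indicator (cball 0 K) x * exp (- (lam * (\<integral>y. w x y \<partial>lborel)))"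
        by (intro tendsto_intros)
    qed
    show "(\<lambda>x. indicator (cball 0 K) x * exp (- (lam * (\<integral>y. w x y \<partial>lborel)))) \<in> borel_measurable lborel"
      unfolding measurable_lborel2
      by (intro borel_measurable_times borel_measurable_indicator measurable_compose[OF _ borel_measurable_exp]
          borel_measurable_uminus borel_measurable_const J_meas) simp
    show "AE x in lborel. norm (H n x) \<le> indicator (cball 0 K) x" for n
      unfolding H_eq using lam_pos v01
      by (intro AE_I2) (auto simp: indicator_def intro!: mult_nonneg_nonneg Bochner_Integration.integral_nonneg)
  qed auto
  moreover have "(\<lambda>n. \<integral>\<omega>. L n \<omega> \<partial>M) \<longlonglongrightarrow>
    (\<integral>\<omega>. (if norm (X (closest X \<omega>) \<omega>) \<le> K then index_prod (UNIV - {closest X \<omega>})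
        (\<lambda>j. if norm (X j \<omega>) \<le> K then 1 - p (X j \<omega> - X (closest X \<omega>) \<omega>) else 1) else 0) \<partial>M)"
  proof (rule integral_dominated_convergence[where w = "\<lambda>\<omega>. real (point_count X (cball 0 K) \<omega>)"])
    \<comment> \<open>Grouping the points of the ball by cell turns \<open>L n\<close> into a sum
      over points.\<close>
    have L_eq: "L n \<omega> = (\<Sum>i | norm (X i \<omega>) \<le> K. \<Prod>j | norm (X j \<omega>) \<le> K. 1 - v n (F n (X i \<omega>)) (X j \<omega>))"
      if "finite {i. norm (X i \<omega>) \<le> K}" for n \<omega>
    proof -
      let ?J = "{i. norm (X i \<omega>) \<le> K}"
      let ?g = "\<lambda>c. \<Prod>j\<in>?J. 1 - v n c (X j \<omega>)"
      have "index_prod UNIV (\<lambda>j. 1 - v n c (X j \<omega>)) = ?g c" for c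
        using that v0 by (intro index_prod_finite) auto
      moreover have "point_count X (A n c) \<omega> = card {i \<in> ?J. F n (X i \<omega>) = c}" for c
        unfolding point_count_def A_def by (rule arg_cong[where f = card]) auto
      ultimately have "L n \<omega> = (\<Sum>c\<in>range (F n). \<Sum>i\<in>{i \<in> ?J. F n (X i \<omega>) = c}. ?g (F n (X i \<omega>)))"
        by (simp add: L_def)
      also have "\<dots> = (\<Sum>i\<in>?J. ?g (F n (X i \<omega>)))"
        using that fin by (intro sum.group) auto
      finally show ?thesis .
    qed
    show "integrable M (\<lambda>\<omega>. real (point_count X (cball 0 K) \<omega>))"
      by (rule integrable.intros[OF expectation_point_count]) auto
    show "AE \<omega> in M. norm (L n \<omega>) \<le> real (point_count X (cball 0 K) \<omega>)" for n
      using AE_locally_finite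
    proof eventually_elim
      case (elim \<omega>)
      have "norm (L n \<omega>) \<le> (\<Sum>i | norm (X i \<omega>) \<le> K. 1)"
        unfolding L_eq[OF elim[rule_format]] using v01
        by (intro sum_norm_le) (auto simp: abs_prod intro!: prod_le_1)
      then show ?case
        by (simp add: point_count_def)
    qed
    show "AE \<omega> in M. (\<lambda>n. L n \<omega>) \<longlonglongrightarrow>
      (if norm (X (closest X \<omega>) \<omega>) \<le> K then index_prod (UNIV - {closest X \<omega>})
        (\<lambda>j. if norm (X j \<omega>) \<le> K then 1 - p (X j \<omega> - X (closest X \<omega>) \<omega>) else 1) else 0)"
      using AE_locally_finite AE_no_ties AE_closest
    proof eventually_elim
      case (elim \<omega>)
      let ?J = "{i. norm (X i \<omega>) \<le> K}"
      let ?c = "closest X \<omega>"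
      have fJ: "finite ?J"
        using elim(1) by blast
      \<comment> \<open>In its own product a point has weight 0 because its cell has been emptied;
        for distinct points the absence of ties makes \<open>v_lim\<close> applicable.\<close>
      have "(\<lambda>n. v n (F n (X i \<omega>)) (X j \<omega>)) \<longlonglongrightarrow> (if j = i then 0 else w (X i \<omega>) (X j \<omega>))" for i j
        using elim(2) v_lim[of "X i \<omega>" "X j \<omega>"] by (auto simp: v_def)
      then have "(\<lambda>n. L n \<omega>) \<longlonglongrightarrow> (\<Sum>i\<in>?J. \<Prod>j\<in>?J. 1 - (if j = i then 0 else w (X i \<omega>) (X j \<omega>)))"
        unfolding L_eq[OF fJ] by (intro tendsto_intros)
      also have "(\<Sum>i\<in>?J. \<Prod>j\<in>?J. 1 - (if j = i then 0 else w (X i \<omega>) (X j \<omega>))) =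
        (if norm (X ?c \<omega>) \<le> K then index_prod (UNIV - {?c})
          (\<lambda>j. if norm (X j \<omega>) \<le> K then 1 - p (X j \<omega> - X ?c \<omega>) else 1) else 0)"
      proof (cases "norm (X ?c \<omega>) \<le> K")
        case True
        \<comment> \<open>For any \<open>i\<close> other than the closest index, the closest point
          lies in the ball through point \<open>i\<close>, where the weight is 1, so one factor is
          0.\<close>
        have "(\<Prod>j\<in>?J. 1 - (if j = i then 0 else w (X i \<omega>) (X j \<omega>))) = 0" if "i \<in> ?J - {?c}" for i
        proof -
          have "norm (X ?c \<omega>) \<le> norm (X i \<omega>)"
            using elim(3) that by (auto intro: less_imp_le)
          then have "1 - (if ?c = i then 0 else w (X i \<omega>) (X ?c \<omega>)) = 0"
            using that True by (auto simp: w_def)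
          with True have "\<exists>j\<in>?J. 1 - (if j = i then 0 else w (X i \<omega>) (X j \<omega>)) = 0"
            by blast
          with fJ show ?thesis
            by (rule prod_zero)
        qed
        then have "(\<Sum>i\<in>?J. \<Prod>j\<in>?J. 1 - (if j = i then 0 else w (X i \<omega>) (X j \<omega>))) =
            (\<Prod>j\<in>?J. 1 - (if j = ?c then 0 else w (X ?c \<omega>) (X j \<omega>)))"
          using fJ True by (subst sum.mono_neutral_right[of ?J "{?c}"]) auto
        also have "\<dots> = (\<Prod>j\<in>?J - {?c}. 1 - p (X j \<omega> - X ?c \<omega>))"
        proof (rule prod.mono_neutral_cong_right[OF fJ])
          fix j assume "j \<in> ?J - {?c}"
          moreover from this elim(3) have "norm (X ?c \<omega>) < norm (X j \<omega>)"
            by blast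
          ultimately show "1 - (if j = ?c then 0 else w (X ?c \<omega>) (X j \<omega>)) = 1 - p (X j \<omega> - X ?c \<omega>)"
            by (auto simp: w_def)
        qed auto
        also have "\<dots> = (\<Prod>j\<in>?J - {?c}. if norm (X j \<omega>) \<le> K then 1 - p (X j \<omega> - X ?c \<omega>) else 1)"
          by (intro prod.cong) auto
        also have "\<dots> = index_prod (UNIV - {?c}) (\<lambda>j. if norm (X j \<omega>) \<le> K then 1 - p (X j \<omega> - X ?c \<omega>) else 1)"
          using fJ by (intro index_prod_finite[symmetric]) auto
        finally show ?thesis
          using True by simp
      next
        case False
        have "norm (X ?c \<omega>) \<le> norm (X i \<omega>)" for i
          using elim(3) by (cases "i = ?c") (auto intro: less_imp_le)
        with False have "?J = {}"
          by (auto intro: order_trans)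
        with False show ?thesis
          by simp
      qed
      finally show ?case .
    qed
    \<comment> \<open>Measurability is plain for a fixed index, and the random index takes countably
      many values.\<close>
    have "(\<lambda>\<omega>. if norm (X i \<omega>) \<le> K then index_prod (UNIV - {i})
        (\<lambda>j. if norm (X j \<omega>) \<le> K then 1 - p (X j \<omega> - X i \<omega>) else 1) else 0) \<in> borel_measurable M" for i
      by measurable
    then show "(\<lambda>\<omega>. if norm (X (closest X \<omega>) \<omega>) \<le> K then index_prod (UNIV - {closest X \<omega>})
        (\<lambda>j. if norm (X j \<omega>) \<le> K then 1 - p (X j \<omega> - X (closest X \<omega>) \<omega>) else 1) else 0) \<in> borel_measurable M"
      by (rule measurable_compose_countable) measurable
  qed auto
  ultimately show ?thesis
    by (blast intro: LIMSEQ_unique)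
qed

end

text \<open>The cutoff tends to infinity. On the probability side the products are bounded by 1; on
  the space side the weight is 1 on the ball through \<open>x\<close>, so the integrand is at most
  the void probability of that ball, which is integrable by \<open>void\<close>.\<close>

lemma (in poisson_points) closest_point_formula:
  fixes p :: "'b \<Rightarrow> real"
  assumes p: "integrable lborel p"
    and p01: "\<And>z. p z \<in> {0..1}" and cont: "\<And>z. z \<noteq> 0 \<Longrightarrow> isCont p z"
    and void: "integrable lborel (\<lambda>x::'b. exp (- (lam * measure lborel (cball (0::'b) (norm x)))))"
  shows "(\<integral>\<omega>. index_prod (UNIV - {closest X \<omega>}) (\<lambda>j. 1 - p (X j \<omega> - X (closest X \<omega>) \<omega>)) \<partial>M) =
    lam * (\<integral>x. exp (- (lam * measure lborel (cball (0::'b) (norm x)))) *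
      exp (- (lam * (LINT y : UNIV - cball 0 (norm x) | lborel. p (y - x)))) \<partial>lborel)"
proof -
  have p_meas [measurable]: "p \<in> borel_measurable borel"
    using borel_measurable_integrable[OF p] by simp
  define w where "w x y = (if norm y \<le> norm x then 1 else p (y - x))" for x y
  define wK where "wK K x y = (if norm y > K then 0 else if norm y \<le> norm x then 1 else p (y - x))" for K :: real and x y
  have ev: "eventually (\<lambda>n. r \<le> real n) sequentially" for r
    using filterlim_real_sequentially by (simp add: filterlim_at_top)
  have w01: "0 \<le> w x y" "w x y \<le> 1" for x y
    using p01[of "y - x"] by (auto simp: w_def)
  have wK01: "0 \<le> wK K x y" "wK K x y \<le> 1" "wK K x y \<le> w x y" for K x y
    using p01[of "y - x"] by (auto simp: wK_def w_def)
  have int_ball: "integrable lborel (indicator (cball 0 r) :: 'b \<Rightarrow> real)" for r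
    using emeasure_bounded_finite[of "cball (0::'b) r"] by (auto simp: integrable_indicator_iff)
  have int_p: "integrable lborel (\<lambda>y. p (y - x))" for x
  proof -
    have "integrable (distr lborel borel ((+) (- x))) p"
      using p by (simp add: lborel_distr_plus)
    then show ?thesis
      by (subst (asm) integrable_distr_eq) auto
  qed
  have w_meas: "w x \<in> borel_measurable borel" "wK K x \<in> borel_measurable borel" for x K
    unfolding w_def wK_def by measurable
  have int_w: "integrable lborel (w x)" for x
  proof (rule Bochner_Integration.integrable_bound[OF Bochner_Integration.integrable_add[OF int_ball[of "norm x"] int_p[of x]]])
    show "AE y in lborel. norm (w x y) \<le> norm (indicator (cball 0 (norm x)) y + p (y - x))"
      using p01 by (intro AE_I2) (auto simp: w_def indicator_def)
  qed (use w_meas in simp)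
  have int_wK: "integrable lborel (wK K x)" for K x
    by (rule Bochner_Integration.integrable_bound[OF int_w[of x]]) (use wK01 w01 w_meas in auto)
  \<comment> \<open>The ball contributes its volume, which separates the void probability from the
    interaction with the points outside.\<close>
  have w_split: "(\<integral>y. w x y \<partial>lborel) =
      measure lborel (cball (0::'b) (norm x)) + (LINT y : UNIV - cball 0 (norm x) | lborel. p (y - x))" for x
  proof -
    have int2: "integrable lborel (\<lambda>y. indicator (UNIV - cball 0 (norm x)) y * p (y - x))"
      by (rule Bochner_Integration.integrable_bound[OF int_p[of x]]) (auto simp: indicator_def)
    have "(\<integral>y. w x y \<partial>lborel) =
        (\<integral>y. indicator (cball 0 (norm x)) y + indicator (UNIV - cball 0 (norm x)) y * p (y - x) \<partial>lborel)"
      by (intro Bochner_Integration.integral_cong) (auto simp: w_def indicator_def)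
    also have "\<dots> = (\<integral>y. indicator (cball (0::'b) (norm x)) y \<partial>lborel) +
        (\<integral>y. indicator (UNIV - cball 0 (norm x)) y * p (y - x) \<partial>lborel)"
      by (rule Bochner_Integration.integral_add[OF int_ball int2])
    finally show ?thesis
      by (simp add: set_lebesgue_integral_def)
  qed
  define G where "G x = exp (- (lam * (\<integral>y. w x y \<partial>lborel)))" for x
  define f where "f K x = indicator (cball 0 K) x * exp (- (lam * (\<integral>y. wK K x y \<partial>lborel)))" for K x
  have J_meas: "(\<lambda>x. \<integral>y. w x y \<partial>lborel) \<in> borel_measurable borel"
    "(\<lambda>x. \<integral>y. wK K x y \<partial>lborel) \<in> borel_measurable borel" for K
  proof -
    show "(\<lambda>x. \<integral>y. w x y \<partial>lborel) \<in> borel_measurable borel"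
    proof (rule lborel.borel_measurable_lebesgue_integral)
      show "(\<lambda>(x, y). w x y) \<in> borel_measurable (borel \<Otimes>\<^sub>M lborel)"
        unfolding w_def by measurable
    qed
    show "(\<lambda>x. \<integral>y. wK K x y \<partial>lborel) \<in> borel_measurable borel"
    proof (rule lborel.borel_measurable_lebesgue_integral)
      show "(\<lambda>(x, y). wK K x y) \<in> borel_measurable (borel \<Otimes>\<^sub>M lborel)"
        unfolding wK_def by measurable
    qed
  qed
  have "(\<lambda>n. \<integral>x. f (real n) x \<partial>lborel) \<longlonglongrightarrow> (\<integral>x. G x \<partial>lborel)"
  proof (rule integral_dominated_convergence[OF _ _ void])
    show "G \<in> borel_measurable lborel"
      unfolding G_def[abs_def] measurable_lborel2
      by (intro measurable_compose[OF _ borel_measurable_exp] borel_measurable_uminus borel_measurable_times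
          borel_measurable_const J_meas)
    show "f (real n) \<in> borel_measurable lborel" for n
      unfolding f_def[abs_def] measurable_lborel2
      by (intro measurable_compose[OF _ borel_measurable_exp] borel_measurable_uminus borel_measurable_times
          borel_measurable_const borel_measurable_indicator J_meas) simp
    show "AE x in lborel. (\<lambda>n. f (real n) x) \<longlonglongrightarrow> G x"
    proof (rule AE_I2)
      fix x :: 'b
      have "(\<lambda>n. \<integral>y. wK (real n) x y \<partial>lborel) \<longlonglongrightarrow> (\<integral>y. w x y \<partial>lborel)"
      proof (rule integral_dominated_convergence[OF _ _ int_w[of x]])
        show "AE y in lborel. (\<lambda>n. wK (real n) x y) \<longlonglongrightarrow> w x y"
        proof (intro AE_I2 tendsto_eventually)
          show "eventually (\<lambda>n. wK (real n) x y = w x y) sequentially" for y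
            using ev[of "norm y"] by eventually_elim (simp add: w_def wK_def)
        qed
      qed (use w_meas wK01 in auto)
      then have "(\<lambda>n. exp (- (lam * (\<integral>y. wK (real n) x y \<partial>lborel)))) \<longlonglongrightarrow> G x"
        unfolding G_def by (intro tendsto_intros)
      moreover have "eventually (\<lambda>n. exp (- (lam * (\<integral>y. wK (real n) x y \<partial>lborel))) = f (real n) x) sequentially"
        using ev[of "norm x"] by eventually_elim (simp add: f_def)
      ultimately show "(\<lambda>n. f (real n) x) \<longlonglongrightarrow> G x"
        by (rule Lim_transform_eventually)
    qed
    show "AE x in lborel. norm (f (real n) x) \<le> exp (- (lam * measure lborel (cball (0::'b) (norm x))))" for n
    proof (rule AE_I2)
      fix x :: 'b
      have "measure lborel (cball (0::'b) (norm x)) \<le> (\<integral>y. wK (real n) x y \<partial>lborel)" if "norm x \<le> real n"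
      proof -
        have "(\<integral>y. indicator (cball (0::'b) (norm x)) y \<partial>lborel) \<le> (\<integral>y. wK (real n) x y \<partial>lborel)"
          using that p01 by (intro Bochner_Integration.integral_mono int_ball int_wK) (auto simp: wK_def indicator_def)
        then show ?thesis
          by simp
      qed
      then show "norm (f (real n) x) \<le> exp (- (lam * measure lborel (cball (0::'b) (norm x))))"
        using lam_pos by (auto simp: f_def indicator_def)
    qed
  qed
  then have "(\<lambda>n. lam * (\<integral>x. f (real n) x \<partial>lborel)) \<longlonglongrightarrow> lam * (\<integral>x. G x \<partial>lborel)"
    by (intro tendsto_intros)
  moreover define q where "q K i \<omega> = (if norm (X i \<omega>) \<le> K then index_prod (UNIV - {i})
        (\<lambda>j. if norm (X j \<omega>) \<le> K then 1 - p (X j \<omega> - X i \<omega>) else 1) else 0)" for K i \<omega>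
  have q_meas: "(\<lambda>\<omega>. q K (closest X \<omega>) \<omega>) \<in> borel_measurable M" for K
  proof (rule measurable_compose_countable)
    show "q K i \<in> borel_measurable M" for i
      unfolding q_def by measurable
  qed measurable
  have "lam * (\<integral>x. f K x \<partial>lborel) = (\<integral>\<omega>. q K (closest X \<omega>) \<omega> \<partial>M)" for K
    using closest_point_formula_bounded[OF p_meas p01 cont, of K] by (simp add: f_def wK_def q_def)
  moreover have "(\<lambda>n. \<integral>\<omega>. q (real n) (closest X \<omega>) \<omega> \<partial>M) \<longlonglongrightarrow>
      (\<integral>\<omega>. index_prod (UNIV - {closest X \<omega>}) (\<lambda>j. 1 - p (X j \<omega> - X (closest X \<omega>) \<omega>)) \<partial>M)"
  proof (rule integral_dominated_convergence[where w = "\<lambda>_. 1"])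
    have "(\<lambda>\<omega>. index_prod (UNIV - {i}) (\<lambda>j. 1 - p (X j \<omega> - X i \<omega>))) \<in> borel_measurable M" for i
      by measurable
    then show "(\<lambda>\<omega>. index_prod (UNIV - {closest X \<omega>}) (\<lambda>j. 1 - p (X j \<omega> - X (closest X \<omega>) \<omega>))) \<in> borel_measurable M"
      by (rule measurable_compose_countable) measurable
    have "(\<lambda>n. q (real n) i \<omega>) \<longlonglongrightarrow> index_prod (UNIV - {i}) (\<lambda>j. 1 - p (X j \<omega> - X i \<omega>))" for i \<omega>
    proof -
      have "(\<lambda>n. index_prod (UNIV - {i}) (\<lambda>j. if norm (X j \<omega>) \<le> real n then 1 - p (X j \<omega> - X i \<omega>) else 1)) \<longlonglongrightarrow>
          index_prod (UNIV - {i}) (\<lambda>j. 1 - p (X j \<omega> - X i \<omega>))"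
        using p01 ev by (intro index_prod_truncate_tendsto) auto
      moreover have "eventually (\<lambda>n. index_prod (UNIV - {i})
          (\<lambda>j. if norm (X j \<omega>) \<le> real n then 1 - p (X j \<omega> - X i \<omega>) else 1) = q (real n) i \<omega>) sequentially"
        using ev[of "norm (X i \<omega>)"] by eventually_elim (simp add: q_def)
      ultimately show ?thesis
        by (rule Lim_transform_eventually)
    qed
    then show "AE \<omega> in M. (\<lambda>n. q (real n) (closest X \<omega>) \<omega>) \<longlonglongrightarrow>
        index_prod (UNIV - {closest X \<omega>}) (\<lambda>j. 1 - p (X j \<omega> - X (closest X \<omega>) \<omega>))"
      by (intro AE_I2)
    have "norm (q K i \<omega>) \<le> 1" for K i \<omega>
      using index_prod_bounds[of "UNIV - {i}" "\<lambda>j. if norm (X j \<omega>) \<le> K then 1 - p (X j \<omega> - X i \<omega>) else 1"] p01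
      by (auto simp: q_def)
    then show "AE \<omega> in M. norm (q (real n) (closest X \<omega>) \<omega>) \<le> 1" for n
      by (intro AE_I2)
  qed (auto intro: q_meas)
  ultimately have "(\<integral>\<omega>. index_prod (UNIV - {closest X \<omega>}) (\<lambda>j. 1 - p (X j \<omega> - X (closest X \<omega>) \<omega>)) \<partial>M) =
      lam * (\<integral>x. G x \<partial>lborel)"
    by (auto intro: LIMSEQ_unique)
  then show ?thesis
    by (simp add: G_def w_split exp_add[symmetric] algebra_simps)
qed

section \<open>Integrals over the plane\<close>

text \<open>Both measures give a half-line \<open>{..a}\<close> the disc area
  \<open>pi * a^2\<close> if \<open>a >= 0\<close> and 0 otherwise, and half-lines form an
  intersection-stable generator.\<close>

lemma distr_norm_plane:
  "distr lborel borel (norm :: real^2 \<Rightarrow> real) = density lborel (\<lambda>r. ennreal (2 * pi * r * indicator {0<..} r))"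
proof (rule measure_eqI_generator_eq[where E = "range (\<lambda>a::real. {..a})" and \<Omega> = UNIV and A = "\<lambda>n. {..real n}"])
  have "emeasure (density lborel (\<lambda>r. ennreal (2 * pi * r * indicator {0<..} r))) {..a} =
      emeasure (distr lborel borel (norm :: real^2 \<Rightarrow> real)) {..a}" for a
  proof (cases "a \<ge> 0")
    case True
    have "emeasure (density lborel (\<lambda>r. ennreal (2 * pi * r * indicator {0<..} r))) {..a} =
        (\<integral>\<^sup>+r. ennreal (2 * pi * r) * indicator {0..a} r \<partial>lborel)"
      by (subst emeasure_density) (auto intro!: nn_integral_cong simp: indicator_def)
    also have "\<dots> = ennreal (pi * a\<^sup>2 - pi * 0\<^sup>2)"
      using True by (intro nn_integral_FTC_Icc) (auto intro!: derivative_eq_intros)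
    also have "\<dots> = emeasure lborel (cball (0::real^2) a)"
      using True by (simp add: emeasure_cball unit_ball_vol_2)
    also have "cball (0::real^2) a = norm -` {..a}"
      by auto
    finally show ?thesis
      by (simp add: emeasure_distr)
  next
    case False
    have "emeasure (density lborel (\<lambda>r. ennreal (2 * pi * r * indicator {0<..} r))) {..a} = 0"
      using False by (subst emeasure_density) (auto intro!: nn_integral_zero' simp: indicator_def)
    moreover have "norm -` {..a} = ({} :: (real^2) set)"
      using False by (auto dest: order_trans[OF norm_ge_zero])
    ultimately show ?thesis
      by (simp add: emeasure_distr)
  qed
  note * = this
  show "emeasure (distr lborel borel (norm :: real^2 \<Rightarrow> real)) Y =
      emeasure (density lborel (\<lambda>r. ennreal (2 * pi * r * indicator {0<..} r))) Y" if "Y \<in> range (\<lambda>a. {..a})" for Y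
    using that * by auto
  show "Int_stable (range (\<lambda>a::real. {..a}))"
    by (auto simp: Int_stable_def)
  show "(\<Union>n. {..real n}) = UNIV"
    using real_arch_simple by auto
  have "emeasure (distr lborel borel (norm :: real^2 \<Rightarrow> real)) {..real n} = emeasure lborel (cball (0::real^2) (real n))" for n
    by (auto simp: emeasure_distr intro!: arg_cong[where f = "emeasure lborel"])
  then show "emeasure (distr lborel borel (norm :: real^2 \<Rightarrow> real)) {..real n} \<noteq> \<infinity>" for n
    using emeasure_bounded_finite[of "cball (0::real^2) (real n)"] by simp
qed (auto simp: borel_eq_atMost)

lemma
  fixes g :: "real \<Rightarrow> real"
  assumes g [measurable]: "g \<in> borel_measurable borel"
  shows integral_radial_plane:
      "(\<integral>x. g (norm (x :: real^2)) \<partial>lborel) = (LINT r : {0<..} | lborel. 2 * pi * r * g r)"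
    and integrable_radial_plane:
      "integrable lborel (\<lambda>x::real^2. g (norm x)) \<longleftrightarrow> set_integrable lborel {0<..} (\<lambda>r. 2 * pi * r * g r)"
proof -
  let ?h = "\<lambda>r. 2 * pi * r * indicator {0<..} r :: real"
  have h: "AE r in lborel. 0 \<le> ?h r"
    by (auto simp: indicator_def)
  have eq: "indicator {0<..} r *\<^sub>R (2 * pi * r * g r) = ?h r * g r" for r
    by simp
  have "(\<integral>x. g (norm (x :: real^2)) \<partial>lborel) = (\<integral>r. g r \<partial>distr lborel borel (norm :: real^2 \<Rightarrow> real))"
    by (subst integral_distr) auto
  also have "\<dots> = (\<integral>r. ?h r * g r \<partial>lborel)"
    unfolding distr_norm_plane using h by (intro integral_real_density) auto
  finally show "(\<integral>x. g (norm (x :: real^2)) \<partial>lborel) = (LINT r : {0<..} | lborel. 2 * pi * r * g r)"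
    by (simp only: set_lebesgue_integral_def eq)
  have "integrable lborel (\<lambda>x::real^2. g (norm x)) \<longleftrightarrow> integrable (distr lborel borel (norm :: real^2 \<Rightarrow> real)) g"
    by (subst integrable_distr_eq) auto
  also have "\<dots> \<longleftrightarrow> integrable lborel (\<lambda>r. ?h r * g r)"
    unfolding distr_norm_plane using h by (intro integrable_real_density) auto
  finally show "integrable lborel (\<lambda>x::real^2. g (norm x)) \<longleftrightarrow> set_integrable lborel {0<..} (\<lambda>r. 2 * pi * r * g r)"
    by (simp only: set_integrable_def eq)
qed

text \<open>The radial integrand, with its Jacobian, is compared with a multiple of
  \<open>1 / (1 + r^2)\<close>.\<close>

lemma integrable_exp_minus_powr_plane:
  assumes "c > 0" "a > 0"
  shows "integrable lborel (\<lambda>x::real^2. exp (- (c * norm x powr a)))"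
proof -
  let ?g = "\<lambda>r::real. 2 * pi * r * exp (- (c * r powr a))"
  have "((\<lambda>r::real. 2 * pi * r * (1 + r\<^sup>2) * exp (- (c * r powr a))) \<longlongrightarrow> 0) at_top"
    using assms by real_asymp
  then have "eventually (\<lambda>r::real. 2 * pi * r * (1 + r\<^sup>2) * exp (- (c * r powr a)) < 1) at_top"
    by (rule order_tendstoD) simp
  then obtain R where R: "\<And>r. r \<ge> R \<Longrightarrow> 2 * pi * r * (1 + r\<^sup>2) * exp (- (c * r powr a)) < 1"
    by (auto simp: eventually_at_top_linorder)
  \<comment> \<open>The entry 1 serves \<open>r >= R\<close>, by the choice of \<open>R\<close>; the
    other entry serves \<open>0 < r < R\<close>, where the exponential is bounded by 1.\<close>
  define B where "B = max 1 (2 * pi * \<bar>R\<bar> * (1 + \<bar>R\<bar>\<^sup>2))"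
  have B: "?g r \<le> B * inverse (1 + r\<^sup>2)" if "r > 0" for r
  proof -
    have "2 * pi * r * (1 + r\<^sup>2) * exp (- (c * r powr a)) \<le> B"
    proof (cases "r \<ge> R")
      case True
      then show ?thesis
        using R[of r] by (simp add: B_def)
    next
      case False
      have "2 * pi * r * (1 + r\<^sup>2) * exp (- (c * r powr a)) \<le> 2 * pi * r * (1 + r\<^sup>2) * 1"
        using that assms by (intro mult_left_mono) auto
      also have "\<dots> \<le> 2 * pi * \<bar>R\<bar> * (1 + \<bar>R\<bar>\<^sup>2) * 1"
        using that False by (intro mult_mono add_mono power_mono) auto
      finally show ?thesis
        unfolding B_def by (simp only: mult_1_right max.coboundedI2)
    qed
    moreover have "0 < 1 + r\<^sup>2"
      by (simp add: add_pos_nonneg)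
    ultimately show ?thesis
      by (simp add: field_simps)
  qed
  have "integrable lborel (\<lambda>r::real. inverse (1 + r\<^sup>2))"
    using integrable_inverse_1_plus_square by (simp add: set_integrable_def)
  then have "set_integrable lborel {0<..} ?g"
    unfolding set_integrable_def
  proof (rule Bochner_Integration.integrable_bound[OF Bochner_Integration.integrable_mult_right[of B]])
    have "norm (indicator {0<..} r *\<^sub>R ?g r) \<le> norm (B * inverse (1 + r\<^sup>2))" for r :: real
      using B[of r] by (auto simp: B_def indicator_def abs_mult)
    then show "AE r in lborel. norm (indicator {0<..} r *\<^sub>R ?g r) \<le> norm (B * inverse (1 + r\<^sup>2))"
      by (intro AE_I2)
  qed auto
  then show ?thesis
    by (subst integrable_radial_plane) auto
qed

text \<open>Boxes determine Lebesgue measure, and the preimage of a box is its image under the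
  inverse map, which is again orthogonal and preserves volume.\<close>

lemma distr_orthogonal_transformation:
  fixes f :: "real^'n::{finite,wellorder} \<Rightarrow> real^'n::_"
  assumes f: "orthogonal_transformation f"
  shows "distr lborel borel f = lborel"
proof (rule lborel_eqI[symmetric])
  have lin: "linear f"
    using f by (rule orthogonal_transformation_linear)
  then have [measurable]: "f \<in> borel_measurable borel"
    by (intro borel_measurable_continuous_onI linear_continuous_on) (simp add: linear_conv_bounded_linear)
  obtain g where g: "orthogonal_transformation g" "\<And>x. g (f x) = x" "\<And>x. f (g x) = x"
    using orthogonal_transformation_inv[OF f] orthogonal_transformation_bij[OF f]
    by (metis bij_inv_eq_iff)
  fix l u :: "(real, 'n) vec" assume "\<And>b. b \<in> Basis \<Longrightarrow> l \<bullet> b \<le> u \<bullet> b"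
  then have box: "emeasure lborel (box l u) = (\<Prod>b\<in>Basis. (u - l) \<bullet> b)"
    by (simp add: emeasure_lborel_box inner_diff_left)
  have "emeasure (distr lborel borel f) (box l u) = emeasure lborel (f -` box l u)"
    by (simp add: emeasure_distr)
  also have "f -` box l u = g ` box l u"
    using g by (auto simp: image_iff) metis
  also have "emeasure lborel (g ` box l u) = emeasure lborel (box l u)"
  proof -
    have lm: "box l u \<in> lmeasurable"
      by simp
    have "bounded (g ` box l u)"
      using g(1) by (intro bounded_linear_image) (auto simp: orthogonal_transformation_linear linear_conv_bounded_linear[symmetric])
    moreover have "g ` box l u = f -` box l u"
      using g by (auto simp: image_iff) metis
    then have "g ` box l u \<in> sets borel"
      using measurable_sets[of f borel borel "box l u"] by simp
    ultimately have "emeasure lborel (g ` box l u) = ennreal (measure lebesgue (g ` box l u))"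
      using emeasure_bounded_finite by (subst emeasure_eq_ennreal_measure) (auto simp: less_top)
    then show ?thesis
      using emeasure_bounded_finite[OF bounded_box[of l u]] by (simp add: measure_orthogonal_image[OF g(1) lm]
        emeasure_eq_ennreal_measure[of lborel "box l u"] less_top)
  qed
  finally show "emeasure (distr lborel borel f) (box l u) = (\<Prod>b\<in>Basis. (u - l) \<bullet> b)"
    using box by simp
qed simp

lemma vector_axis_2: "vector [r, 0] = (r *\<^sub>R axis 1 1 :: real^2)"
  by (simp add: vec_eq_iff forall_2 axis_def)

text \<open>An orthogonal map takes \<open>(norm x, 0)\<close> to \<open>x\<close> and preserves
  balls about the origin. This removes the direction of the tagged point and leaves the form in
  which \<open>N2W\<close> is defined.\<close>

lemma outer_integral_rotation:
  fixes h :: "real \<Rightarrow> real" and x :: "real^2"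
  assumes [measurable]: "h \<in> borel_measurable borel"
  shows "(LINT y : UNIV - cball 0 (norm x) | lborel. h (norm (y - x))) =
    (LINT y : UNIV - cball 0 (norm x) | lborel. h (norm (y - (vector [norm x, 0] :: real^2))))"
proof -
  let ?e = "vector [norm x, 0] :: real^2"
  have "norm ?e = norm x"
    by (simp add: vector_axis_2)
  then obtain f where f: "orthogonal_transformation f" "f ?e = x"
    using orthogonal_transformation_exists by blast
  then have lin: "linear f" and nrm: "\<And>y. norm (f y) = norm y"
    by (auto simp: orthogonal_transformation)
  have [measurable]: "f \<in> borel_measurable borel"
    using lin by (intro borel_measurable_continuous_onI linear_continuous_on) (simp add: linear_conv_bounded_linear)
  have [measurable]: "UNIV - cball (0 :: real^2) r \<in> sets borel" for r
    by (intro borel_open open_Diff) auto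
  have sub: "norm (f y - x) = norm (y - ?e)" for y
    using nrm[of "y - ?e"] f(2) lin by (simp add: linear_diff)
  have "(LINT y : UNIV - cball 0 (norm x) | lborel. h (norm (y - x))) =
      (\<integral>y. indicator (UNIV - cball 0 (norm x)) y *\<^sub>R h (norm (y - x)) \<partial>distr lborel borel f)"
    by (simp add: set_lebesgue_integral_def distr_orthogonal_transformation[OF f(1)])
  also have "\<dots> = (\<integral>y. indicator (UNIV - cball 0 (norm x)) (f y) *\<^sub>R h (norm (f y - x)) \<partial>lborel)"
    by (subst integral_distr) auto
  also have "\<dots> = (LINT y : UNIV - cball 0 (norm x) | lborel. h (norm (y - ?e)))"
    unfolding set_lebesgue_integral_def sub
    by (intro Bochner_Integration.integral_cong) (auto simp: indicator_def nrm)
  finally show ?thesis .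
qed

lemma measure_cball_plane: "r \<ge> 0 \<Longrightarrow> measure lborel (cball (0 :: real^2) r) = pi * r\<^sup>2"
  by (simp add: content_cball unit_ball_vol_2)

section \<open>Independence\<close>

text \<open>Independence of intersection-stable families passes to the sigma-algebras generated by
  disjoint blocks of them; each variable is measurable with respect to its own block.\<close>

lemma (in prob_space) indep_vars_blocks:
  assumes indep: "indep_sets E (\<Union>l\<in>L. K l)" and stable: "\<And>i. Int_stable (E i)"
    and disj: "disjoint_family_on K L"
    and Z: "\<And>l. l \<in> L \<Longrightarrow> Z l \<in> sigma (space M) (\<Union>i\<in>K l. E i) \<rightarrow>\<^sub>M N l"
  shows "indep_vars N Z L"
proof -
  have sub: "(\<Union>i\<in>K l. E i) \<subseteq> events" if "l \<in> L" for l
    using indep that unfolding indep_sets_def by blast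
  have sets: "sets (sigma (space M) (\<Union>i\<in>K l. E i)) = sigma_sets (space M) (\<Union>i\<in>K l. E i)" if "l \<in> L" for l
    using sub[OF that] sets.space_closed by (intro sets_measure_of) blast
  have pre: "Z l -` A \<inter> space M \<in> sigma_sets (space M) (\<Union>i\<in>K l. E i)" if "l \<in> L" "A \<in> sets (N l)" for l A
    using measurable_sets[OF Z[OF that(1)] that(2)] sets[OF that(1)] by (simp add: space_measure_of_conv)
  have "indep_sets (\<lambda>l. sigma_sets (space M) (\<Union>i\<in>K l. E i)) L"
    using indep stable disj by (rule indep_sets_collect_sigma)
  then have "indep_sets (\<lambda>l. {Z l -` A \<inter> space M | A. A \<in> sets (N l)}) L"
    by (rule indep_sets_mono_sets) (use pre in blast)
  moreover have "Z l \<in> M \<rightarrow>\<^sub>M N l" if l: "l \<in> L" for l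
  proof (rule measurableI)
    show "Z l \<omega> \<in> space (N l)" if "\<omega> \<in> space M" for \<omega>
      using measurable_space[OF Z[OF l]] that by (simp add: space_measure_of_conv)
    show "Z l -` A \<inter> space M \<in> sets M" if "A \<in> sets (N l)" for A
      using pre[OF l that] sets.sigma_sets_subset[OF sub[OF l]] by blast
  qed
  ultimately show ?thesis
    by (simp add: indep_vars_def2)
qed

lemma (in prob_space) indep_var_blocks:
  assumes indep: "indep_sets E (I \<union> J)" and stable: "\<And>i. Int_stable (E i)" and disj: "I \<inter> J = {}"
    and A: "A \<in> sigma (space M) (\<Union>i\<in>I. E i) \<rightarrow>\<^sub>M S" and B: "B \<in> sigma (space M) (\<Union>i\<in>J. E i) \<rightarrow>\<^sub>M T"
  shows "indep_var S A T B"
  unfolding indep_var_def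
proof (rule indep_vars_blocks[where E = E and K = "case_bool I J"])
  show "indep_sets E (\<Union>l\<in>UNIV. case_bool I J l)"
    using indep by (simp add: UNIV_bool Un_commute)
  show "disjoint_family (case_bool I J)"
    using disj by (auto simp: disjoint_family_on_def split: bool.splits)
  show "case_bool A B l \<in> sigma (space M) (\<Union>i\<in>case_bool I J l. E i) \<rightarrow>\<^sub>M case_bool S T l" for l
    using A B by (cases l) simp_all
qed (rule stable)

lemma integral_Fubini_bounded:
  fixes f :: "'a \<times> 'b \<Rightarrow> real"
  assumes "finite_measure M" "finite_measure N"
    and f: "f \<in> borel_measurable (M \<Otimes>\<^sub>M N)" and C: "\<And>p. \<bar>f p\<bar> \<le> C"
  shows "(\<integral>x. \<integral>y. f (x, y) \<partial>N \<partial>M) = (\<integral>p. f p \<partial>(M \<Otimes>\<^sub>M N))"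
    and "(\<integral>x. \<integral>y. f (x, y) \<partial>N \<partial>M) = (\<integral>y. \<integral>x. f (x, y) \<partial>M \<partial>N)"
proof -
  interpret M: finite_measure M by fact
  interpret N: finite_measure N by fact
  interpret pair_sigma_finite M N ..
  interpret P: finite_measure "M \<Otimes>\<^sub>M N"
    by (rule finite_measure_pair_measure) fact+
  have int: "integrable (M \<Otimes>\<^sub>M N) f"
    using f C by (intro P.integrable_const_bound[where B = C]) auto
  show "(\<integral>x. \<integral>y. f (x, y) \<partial>N \<partial>M) = (\<integral>p. f p \<partial>(M \<Otimes>\<^sub>M N))"
    by (rule integral_fst'[OF int])
  show "(\<integral>x. \<integral>y. f (x, y) \<partial>N \<partial>M) = (\<integral>y. \<integral>x. f (x, y) \<partial>M \<partial>N)"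
    using Fubini_integral[of "\<lambda>x y. f (x, y)"] int by simp
qed

text \<open>Conditioning on \<open>A\<close> in elementary form: the joint law is a product law, so
  \<open>A\<close> may be frozen at a separate \<open>\<omega>'\<close> while \<open>B\<close> is
  averaged. Both integrals run over \<open>M\<close> itself, which avoids naming the laws of
  \<open>A\<close> and \<open>B\<close> later.\<close>

lemma (in prob_space) integral_decouple_blocks:
  fixes H :: "'b \<times> 'c \<Rightarrow> real"
  assumes indep: "indep_sets E (I \<union> J)" and stable: "\<And>i. Int_stable (E i)" and disj: "I \<inter> J = {}"
    and A: "A \<in> sigma (space M) (\<Union>i\<in>I. E i) \<rightarrow>\<^sub>M S" and B: "B \<in> sigma (space M) (\<Union>i\<in>J. E i) \<rightarrow>\<^sub>M T"
    and H [measurable]: "H \<in> borel_measurable (S \<Otimes>\<^sub>M T)" and C: "\<And>p. \<bar>H p\<bar> \<le> C"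
  shows "(\<integral>\<omega>. H (A \<omega>, B \<omega>) \<partial>M) = (\<integral>\<omega>'. \<integral>\<omega>. H (A \<omega>', B \<omega>) \<partial>M \<partial>M)"
proof -
  have sub: "(\<Union>i\<in>I. E i) \<subseteq> events" "(\<Union>i\<in>J. E i) \<subseteq> events"
    using indep unfolding indep_sets_def by blast+
  have sets: "sets (sigma (space M) (\<Union>i\<in>I. E i)) = sigma_sets (space M) (\<Union>i\<in>I. E i)"
    "sets (sigma (space M) (\<Union>i\<in>J. E i)) = sigma_sets (space M) (\<Union>i\<in>J. E i)"
    using sub sets.space_closed by (intro sets_measure_of; blast)+
  have preA: "A -` a \<inter> space M \<in> sigma_sets (space M) (\<Union>i\<in>I. E i)" if "a \<in> sets S" for a
    using measurable_sets[OF A that] sets by (simp add: space_measure_of_conv)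
  have preB: "B -` b \<inter> space M \<in> sigma_sets (space M) (\<Union>i\<in>J. E i)" if "b \<in> sets T" for b
    using measurable_sets[OF B that] sets by (simp add: space_measure_of_conv)
  have rv [measurable]: "A \<in> M \<rightarrow>\<^sub>M S" "B \<in> M \<rightarrow>\<^sub>M T"
    using preA preB sets.sigma_sets_subset[OF sub(1)] sets.sigma_sets_subset[OF sub(2)]
      measurable_space[OF A] measurable_space[OF B]
    by (auto intro!: measurableI simp: space_measure_of_conv)
  have "indep_sets (\<lambda>l. sigma_sets (space M) (\<Union>i\<in>case_bool I J l. E i)) UNIV"
    using indep disj by (intro indep_sets_collect_sigma stable)
      (auto simp: UNIV_bool Un_commute disjoint_family_on_def)
  then have ind: "indep_set (sigma_sets (space M) (\<Union>i\<in>I. E i)) (sigma_sets (space M) (\<Union>i\<in>J. E i))"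
    unfolding indep_set_def by (rule indep_sets_mono_sets) (auto split: bool.split)
  interpret A: prob_space "distr M S A"
    by (rule prob_space_distr) measurable
  interpret B: prob_space "distr M T B"
    by (rule prob_space_distr) measurable
  have joint: "distr M S A \<Otimes>\<^sub>M distr M T B = distr M (S \<Otimes>\<^sub>M T) (\<lambda>\<omega>. (A \<omega>, B \<omega>))"
  proof (rule pair_measure_eqI)
    fix a b assume ab: "a \<in> sets (distr M S A)" "b \<in> sets (distr M T B)"
    have "emeasure (distr M (S \<Otimes>\<^sub>M T) (\<lambda>\<omega>. (A \<omega>, B \<omega>))) (a \<times> b) =
        emeasure M ((A -` a \<inter> space M) \<inter> (B -` b \<inter> space M))"
      using ab by (subst emeasure_distr) (auto intro!: arg_cong[where f = "emeasure M"])
    also have "\<dots> = emeasure M (A -` a \<inter> space M) * emeasure M (B -` b \<inter> space M)"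
      using indep_setD[OF ind preA preB] ab by (simp add: emeasure_eq_measure ennreal_mult)
    finally show "emeasure (distr M S A) a * emeasure (distr M T B) b =
        emeasure (distr M (S \<Otimes>\<^sub>M T) (\<lambda>\<omega>. (A \<omega>, B \<omega>))) (a \<times> b)"
      using ab by (simp add: emeasure_distr)
  qed (auto intro: A.sigma_finite_measure_axioms B.sigma_finite_measure_axioms
       cong: sets_pair_measure_cong)
  have "(\<integral>\<omega>. H (A \<omega>, B \<omega>) \<partial>M) = (\<integral>p. H p \<partial>distr M (S \<Otimes>\<^sub>M T) (\<lambda>\<omega>. (A \<omega>, B \<omega>)))"
    by (subst integral_distr) auto
  also have "\<dots> = (\<integral>p. H p \<partial>(distr M S A \<Otimes>\<^sub>M distr M T B))"
    by (simp add: joint)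
  also have "\<dots> = (\<integral>a. \<integral>b. H (a, b) \<partial>distr M T B \<partial>distr M S A)"
    using C H by (intro integral_Fubini_bounded(1)[symmetric] A.finite_measure_axioms B.finite_measure_axioms)
      (simp_all cong: measurable_cong_sets sets_pair_measure_cong)
  also have "\<dots> = (\<integral>\<omega>'. \<integral>b. H (A \<omega>', b) \<partial>distr M T B \<partial>M)"
    by (subst integral_distr) auto
  also have "\<dots> = (\<integral>\<omega>'. \<integral>\<omega>. H (A \<omega>', B \<omega>) \<partial>M \<partial>M)"
  proof (rule Bochner_Integration.integral_cong[OF refl])
    fix \<omega>' assume "\<omega>' \<in> space M"
    then have [measurable]: "A \<omega>' \<in> space S"
      by (rule measurable_space[OF rv(1)])
    show "(\<integral>b. H (A \<omega>', b) \<partial>distr M T B) = (\<integral>\<omega>. H (A \<omega>', B \<omega>) \<partial>M)"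
      by (subst integral_distr) auto
  qed
  finally show ?thesis .
qed

section \<open>Mean of a single access factor\<close>

lemma access_factor_eq:
  "access_factor s t g d \<theta> = 1 - of_bool (s < t \<and> \<theta> < g / d)"
  by (auto simp: access_factor_def)

lemma access_factor_01: "access_factor s t g d \<theta> \<in> {0..1}"
  by (simp add: access_factor_eq)

lemma borel_measurable_access_factor [measurable (raw)]:
  assumes [measurable]: "s \<in> borel_measurable N" "t \<in> borel_measurable N" "g \<in> borel_measurable N" "d \<in> borel_measurable N"
  shows "(\<lambda>x. access_factor (s x) (t x) (g x) (d x) \<theta>) \<in> borel_measurable N"
  unfolding access_factor_eq by measurable

lemma path_loss_pos: "c > 0 \<Longrightarrow> d > 0 \<Longrightarrow> path_loss c a d > 0"
  by (simp add: path_loss_def)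

lemma borel_measurable_path_loss [measurable]: "path_loss c a \<in> borel_measurable borel"
  unfolding path_loss_def[abs_def] by measurable

abbreviation (input) unit_uniform :: "real measure" where
  "unit_uniform \<equiv> uniform_measure lborel {0..1}"

lemma prob_space_unit_uniform: "prob_space unit_uniform"
  by (rule prob_space_uniform_measure) simp_all

text \<open>For \<open>d > 0\<close> the factor is 0 exactly when \<open>T < t\<close> and
  \<open>G > \<theta> * d\<close>, independent events of probability \<open>t\<close> and
  \<open>exp (- (\<mu> * \<theta> * d))\<close>. At \<open>d = 0\<close> the quotient
  \<open>G / 0\<close> is 0 and the factor is always 1.\<close>

lemma (in prob_space) expectation_access_factor:
  assumes ind: "indep_var borel T borel G"
    and T: "distr M borel T = unit_uniform" and G: "distributed M lborel G (exponential_density \<mu>)"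
    and pos: "\<mu> > 0" "\<theta> > 0" "d \<ge> 0" and t: "t \<in> {0..1}"
  shows "(\<integral>\<omega>. access_factor (T \<omega>) t (G \<omega>) d \<theta> \<partial>M) = 1 - t * (if d = 0 then 0 else exp (- (\<mu> * \<theta> * d)))"
proof (cases "d = 0")
  case True
  then show ?thesis
    using pos by (simp add: access_factor_eq prob_space)
next
  case False
  with pos have d: "d > 0" by simp
  have [measurable]: "T \<in> borel_measurable M" "G \<in> borel_measurable M"
    using ind by (auto dest: indep_var_rv1 indep_var_rv2)
  have T_less: "\<P>(\<omega> in M. T \<omega> < t) = t"
  proof -
    have "\<P>(\<omega> in M. T \<omega> < t) = measure (distr M borel T) {..<t}"
      by (simp add: measure_distr vimage_def Int_def conj_commute)
    also have "\<dots> = measure lborel ({0..1} \<inter> {..<t})"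
      unfolding T by (subst measure_uniform_measure) auto
    also have "{0..1} \<inter> {..<t} = {0..<t}"
      using t by auto
    finally show ?thesis
      using t by simp
  qed
  have G_gt: "\<P>(\<omega> in M. \<theta> * d < G \<omega>) = exp (- (\<mu> * \<theta> * d))"
    using exponential_distributedD_gt[OF G, of "\<theta> * d"] pos by (simp add: ac_simps)
  have "(\<integral>\<omega>. access_factor (T \<omega>) t (G \<omega>) d \<theta> \<partial>M) =
      (\<integral>\<omega>. 1 - indicator {\<omega> \<in> space M. T \<omega> \<in> {..<t} \<and> G \<omega> \<in> {\<theta> * d<..}} \<omega> \<partial>M)"
    using d by (intro Bochner_Integration.integral_cong) (auto simp: access_factor_eq indicator_def field_simps)
  also have "\<dots> = 1 - \<P>(\<omega> in M. T \<omega> \<in> {..<t} \<and> G \<omega> \<in> {\<theta> * d<..})"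
    by (subst Bochner_Integration.integral_diff) (auto simp: prob_space integrable_indicator_iff less_top[symmetric])
  also have "\<dots> = 1 - \<P>(\<omega> in M. T \<omega> < t) * \<P>(\<omega> in M. \<theta> * d < G \<omega>)"
    by (subst prob_indep_random_variable[OF ind]) auto
  finally show ?thesis
    using d by (simp add: T_less G_gt)
qed

lemma integral_unit_uniform_exp:
  assumes "k > 0"
  shows "(\<integral>t. exp (- (t * k)) \<partial>unit_uniform) = (1 - exp (- k)) / k"
proof -
  have "unit_uniform = density lborel (\<lambda>t. ennreal (indicator {0..1} t))"
    unfolding uniform_measure_def by (intro density_cong) (auto simp: indicator_def)
  then have "(\<integral>t. exp (- (t * k)) \<partial>unit_uniform) = (\<integral>t. indicator {0..1} t * exp (- (t * k)) \<partial>lborel)"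
    by (simp add: integral_real_density)
  also have "\<dots> = (\<integral>t. exp (- (t * k)) * indicator {0..1} t \<partial>lborel)"
    by (simp only: mult.commute)
  also have "\<dots> = - exp (- (1 * k)) / k - (- exp (- (0 * k)) / k)"
    using assms
    by (intro integral_FTC_Icc_real[where F = "\<lambda>t. - exp (- (t * k)) / k"])
      (auto intro!: derivative_eq_intros continuous_intros)
  finally show ?thesis
    using assms by (simp add: diff_divide_distrib)
qed

section \<open>Medium access\<close>

text \<open>Only access of a point of \<open>X\<close> is treated here. The locale is interpreted a
  second time with the networks exchanged; all four fading families are parameters because that
  exchange permutes them.\<close>

locale contention = prob_space M
  for M :: "'a measure" +
  fixes X Y :: "nat \<Rightarrow> 'a \<Rightarrow> real^2"
    and tW tL :: "nat \<Rightarrow> 'a \<Rightarrow> real"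
    and GW GLW GWL GL :: "nat \<Rightarrow> nat \<Rightarrow> 'a \<Rightarrow> real"
    and lamW lamL lamc \<alpha> \<mu> :: real
  assumes pos: "lamW > 0" "lamL > 0" "lamc > 0" "\<alpha> > 0" "\<mu> > 0"
    and poisson_W: "homogeneous_poisson_process M lamW X"
    and poisson_L: "homogeneous_poisson_process M lamL Y"
    and timer_W: "\<And>i. tW i \<in> borel_measurable M \<and> distr M borel (tW i) = unit_uniform"
    and timer_L: "\<And>k. tL k \<in> borel_measurable M \<and> distr M borel (tL k) = unit_uniform"
    and fading_W: "\<And>j i. distributed M lborel (GW j i) (exponential_density \<mu>)"
    and fading_LW: "\<And>m i. distributed M lborel (GLW m i) (exponential_density \<mu>)"
    and indep_sources: "indep_sets (source_events M X Y tW tL GW GLW GWL GL) UNIV"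

sublocale contention \<subseteq> W: poisson_points M lamW X
  by unfold_locales (use pos poisson_W in auto)

sublocale contention \<subseteq> L: poisson_points M lamL Y
  by unfold_locales (use pos poisson_L in auto)

context contention
begin

section \<open>Sources and the information carried by sets of sources\<close>

abbreviation "evs \<equiv> source_events M X Y tW tL GW GLW GWL GL"

abbreviation "src K \<equiv> sigma (space M) (\<Union>s\<in>K. evs s)"

lemma Int_stable_evs: "Int_stable (evs s)"
  by (cases s) (simp_all add: sets.Int_stable)

lemma indep_evs: "indep_sets evs K"
  using indep_sources by (rule indep_sets_mono_index[rotated]) simp

lemma measurable_src:
  assumes "s \<in> K" "evs s = generated_events M f N" "f \<in> space M \<rightarrow> space N"
  shows "f \<in> src K \<rightarrow>\<^sub>M N"
proof (rule measurableI)
  have "(\<Union>s\<in>K. evs s) \<subseteq> events"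
    using indep_sources unfolding indep_sets_def by blast
  then have sets: "sets (src K) = sigma_sets (space M) (\<Union>s\<in>K. evs s)"
    using sets.space_closed by (intro sets_measure_of) blast
  show "f \<omega> \<in> space N" if "\<omega> \<in> space (src K)" for \<omega>
    using that assms by (auto simp: space_measure_of_conv)
  show "f -` A \<inter> space (src K) \<in> sets (src K)" if "A \<in> sets N" for A
    using in_vimage_algebra[OF that, of f "space M"] assms(1,2)
    unfolding sets by (auto simp: space_measure_of_conv)
qed

text \<open>Timers and the fadings towards an AP are bundled into one real family indexed by
  \<open>source\<close>, so that a whole block of them is a single random element of a product
  space; the value 0 fills the other indices.\<close>

definition mark :: "source \<Rightarrow> 'a \<Rightarrow> real" where
  "mark s = (case s of TimerW i \<Rightarrow> tW i | TimerL k \<Rightarrow> tL k | FadingW j i \<Rightarrow> GW j i | FadingLW m i \<Rightarrow> GLW m i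
     | _ \<Rightarrow> (\<lambda>_. 0))"

lemma mark_simps [simp]:
  "mark (TimerW i) = tW i" "mark (TimerL k) = tL k" "mark (FadingW j i) = GW j i" "mark (FadingLW m i) = GLW m i"
  by (simp_all add: mark_def)

lemma measurable_mark_src: "s \<in> K \<Longrightarrow> mark s \<in> src K \<rightarrow>\<^sub>M borel"
  by (cases s) (auto simp: mark_def intro: measurable_src)

lemma measurable_points_src:
  "PointsW \<in> K \<Longrightarrow> (\<lambda>\<omega> i. X i \<omega>) \<in> src K \<rightarrow>\<^sub>M Pi\<^sub>M UNIV (\<lambda>_. borel)"
  "PointsL \<in> K \<Longrightarrow> (\<lambda>\<omega> k. Y k \<omega>) \<in> src K \<rightarrow>\<^sub>M Pi\<^sub>M UNIV (\<lambda>_. borel)"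
  by (auto simp: space_PiM intro!: measurable_src)

lemma measurable_sources [measurable]:
  "tW i \<in> borel_measurable M" "tL i \<in> borel_measurable M"
  "GW j i \<in> borel_measurable M" "GLW j i \<in> borel_measurable M"
  using timer_W timer_L distributed_measurable[OF fading_W] distributed_measurable[OF fading_LW] by auto

text \<open>The value at 0 reflects \<open>g / 0 = 0\<close>: a transmitter at path loss 0 is never sensed by \<^const>\<open>access_factor\<close>.\<close>

definition sense :: "real \<Rightarrow> real \<Rightarrow> real" where
  "sense \<theta> d = (if d = 0 then 0 else exp (- (\<mu> * \<theta> * d)))"

lemma sense_01:
  assumes "\<theta> > 0" "d \<ge> 0"
  shows "sense \<theta> d \<in> {0..1}"
  using assms pos by (simp add: sense_def)

lemma mult_sense_01:
  assumes "\<theta> > 0" "d \<ge> 0" "t \<in> {0..1}"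
  shows "t * sense \<theta> d \<in> {0..1}"
  using sense_01[OF assms(1,2)] assms(3) by (auto intro: mult_le_one)

text \<open>The points are frozen: \<open>d\<close> and \<open>e\<close> stand for the path losses
  to the tagged device. Its timer is shared by all factors and is split off first; for a fixed value
  of it, each factor depends on its own pair of timer and fading.\<close>

lemma expectation_finite_product:
  assumes \<theta>: "\<theta>1 > 0" "\<theta>2 > 0" and d: "\<And>j. d j \<ge> 0" "\<And>m. e m \<ge> 0"
    and J: "finite J" "finite J'" "i \<notin> J"
  shows "(\<integral>\<omega>. (\<Prod>j\<in>J. access_factor (tW j \<omega>) (tW i \<omega>) (GW j i \<omega>) (d j) \<theta>1) *
      (\<Prod>m\<in>J'. access_factor (tL m \<omega>) (tW i \<omega>) (GLW m i \<omega>) (e m) \<theta>2) \<partial>M) =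
    (\<integral>t. (\<Prod>j\<in>J. 1 - t * sense \<theta>1 (d j)) * (\<Prod>m\<in>J'. 1 - t * sense \<theta>2 (e m)) \<partial>unit_uniform)"
proof -
  let ?K = "UNIV - {PointsW, PointsL, TimerW i}"
  let ?PM = "Pi\<^sub>M UNIV (\<lambda>_. borel) :: (source \<Rightarrow> real) measure"
  \<comment> \<open>Coordinates outside \<open>?K\<close> are set to 0, which makes \<open>B\<close>
    measurable for that block; \<open>H\<close> reads none of them, since \<open>i\<close> is not in
    \<open>J\<close>.\<close>
  define B where "B \<omega> s = (if s \<in> ?K then mark s \<omega> else 0)" for \<omega> s
  define H where "H = (\<lambda>(t, b). (\<Prod>j\<in>J. access_factor (b (TimerW j)) t (b (FadingW j i)) (d j) \<theta>1) *
    (\<Prod>m\<in>J'. access_factor (b (TimerL m)) t (b (FadingLW m i)) (e m) \<theta>2))"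
  define Q where "Q t = (\<Prod>j\<in>J. 1 - t * sense \<theta>1 (d j)) * (\<Prod>m\<in>J'. 1 - t * sense \<theta>2 (e m))" for t
  have B_src: "B \<in> src ?K \<rightarrow>\<^sub>M ?PM"
  proof (rule measurable_PiM_single')
    show "(\<lambda>\<omega>. B \<omega> s) \<in> borel_measurable (src ?K)" for s
      unfolding B_def by (cases "s \<in> ?K") (simp_all add: measurable_mark_src)
  qed (simp add: space_PiM)
  have H_meas [measurable]: "H \<in> borel_measurable (borel \<Otimes>\<^sub>M ?PM)"
    unfolding H_def by measurable
  have H_bound: "\<bar>H q\<bar> \<le> 1" for q
    unfolding H_def using access_factor_01
    by (auto simp: abs_mult abs_prod split: prod.split intro!: mult_le_one prod_le_1 prod_nonneg)
  have [measurable]: "B \<in> M \<rightarrow>\<^sub>M ?PM"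
  proof (rule measurable_PiM_single')
    have "mark s \<in> borel_measurable M" for s
      by (cases s) (simp_all add: mark_def)
    then show "(\<lambda>\<omega>. B \<omega> s) \<in> borel_measurable M" for s
      unfolding B_def by (cases "s \<in> ?K") simp_all
  qed (simp add: space_PiM)
  \<comment> \<open>A uniform timer is below \<open>t\<close> with probability \<open>t\<close> only
    for \<open>t\<close> in [0,1], where the law of \<open>tW i\<close> is concentrated.\<close>
  have inner: "(\<integral>\<omega>. H (t, B \<omega>) \<partial>M) = Q t" if t: "t \<in> {0..1}" for t
  proof -
    \<comment> \<open>Each factor is named by the timer of its transmitter; the block
      \<open>K s\<close> adds the fading from that transmitter to \<open>i\<close>.\<close>
    let ?L = "TimerW ` J \<union> TimerL ` J'"
    define K where "K s = (case s of TimerW j \<Rightarrow> {TimerW j, FadingW j i} | TimerL m \<Rightarrow> {TimerL m, FadingLW m i} | _ \<Rightarrow> {})" for s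
    define Z where "Z s \<omega> = (case s of TimerW j \<Rightarrow> access_factor (tW j \<omega>) t (GW j i \<omega>) (d j) \<theta>1
      | TimerL m \<Rightarrow> access_factor (tL m \<omega>) t (GLW m i \<omega>) (e m) \<theta>2 | _ \<Rightarrow> 0)" for s \<omega>
    have prod_L: "(\<Prod>s\<in>?L. f s) = (\<Prod>j\<in>J. f (TimerW j)) * (\<Prod>m\<in>J'. f (TimerL m))" for f :: "source \<Rightarrow> real"
      using J by (subst prod.union_disjoint) (auto simp: prod.reindex inj_on_def)
    have Z01: "Z s \<omega> \<in> {0..1}" for s \<omega>
      using access_factor_01 by (auto simp: Z_def split: source.split)
    have Z_src: "Z s \<in> borel_measurable (src (K s))" if "s \<in> ?L" for s
      using that
    proof
      assume "s \<in> TimerW ` J"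
      then obtain j where s: "s = TimerW j" by auto
      have [measurable]: "tW j \<in> borel_measurable (src (K s))" "GW j i \<in> borel_measurable (src (K s))"
        using measurable_mark_src[of "TimerW j" "K s"] measurable_mark_src[of "FadingW j i" "K s"]
        by (auto simp: K_def s)
      have "(\<lambda>\<omega>. access_factor (tW j \<omega>) t (GW j i \<omega>) (d j) \<theta>1) \<in> borel_measurable (src (K s))"
        by measurable
      then show ?thesis
        by (simp add: Z_def[abs_def] s)
    next
      assume "s \<in> TimerL ` J'"
      then obtain m where s: "s = TimerL m" by auto
      have [measurable]: "tL m \<in> borel_measurable (src (K s))" "GLW m i \<in> borel_measurable (src (K s))"
        using measurable_mark_src[of "TimerL m" "K s"] measurable_mark_src[of "FadingLW m i" "K s"]
        by (auto simp: K_def s)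
      have "(\<lambda>\<omega>. access_factor (tL m \<omega>) t (GLW m i \<omega>) (e m) \<theta>2) \<in> borel_measurable (src (K s))"
        by measurable
      then show ?thesis
        by (simp add: Z_def[abs_def] s)
    qed
    have ind: "indep_vars (\<lambda>_. borel) Z ?L"
      by (rule indep_vars_blocks[OF indep_evs Int_stable_evs _ Z_src])
        (auto simp: disjoint_family_on_def K_def)
    have Z_meas: "Z s \<in> borel_measurable M" if "s \<in> ?L" for s
      using ind that by (simp add: indep_vars_def2)
    have "(\<integral>\<omega>. H (t, B \<omega>) \<partial>M) = (\<integral>\<omega>. (\<Prod>s\<in>?L. Z s \<omega>) \<partial>M)"
      using J(3) unfolding prod_L H_def B_def Z_def
      by (intro Bochner_Integration.integral_cong refl)
        (auto intro!: arg_cong2[where f = "(*)"] prod.cong)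
    also have "\<dots> = (\<Prod>s\<in>?L. \<integral>\<omega>. Z s \<omega> \<partial>M)"
    proof (rule indep_vars_lebesgue_integral[OF _ ind])
      show "integrable M (Z s)" if "s \<in> ?L" for s
        using Z01 by (intro integrable_const_bound[where B = 1] Z_meas[OF that]) auto
    qed (use J in auto)
    also have "\<dots> = Q t"
    proof -
      have "(\<integral>\<omega>. Z (TimerW j) \<omega> \<partial>M) = 1 - t * sense \<theta>1 (d j)" for j
      proof -
        have "indep_var borel (tW j) borel (GW j i)"
          by (rule indep_var_blocks[of evs "{TimerW j}" "{FadingW j i}", OF indep_evs Int_stable_evs])
            (use measurable_mark_src[of "TimerW j" "{TimerW j}"] measurable_mark_src[of "FadingW j i" "{FadingW j i}"] in auto)
        then show ?thesis
          using expectation_access_factor[OF _ conjunct2[OF timer_W] fading_W pos(5) \<theta>(1) d(1) t]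
          by (simp add: Z_def sense_def)
      qed
      moreover have "(\<integral>\<omega>. Z (TimerL m) \<omega> \<partial>M) = 1 - t * sense \<theta>2 (e m)" for m
      proof -
        have "indep_var borel (tL m) borel (GLW m i)"
          by (rule indep_var_blocks[of evs "{TimerL m}" "{FadingLW m i}", OF indep_evs Int_stable_evs])
            (use measurable_mark_src[of "TimerL m" "{TimerL m}"] measurable_mark_src[of "FadingLW m i" "{FadingLW m i}"] in auto)
        then show ?thesis
          using expectation_access_factor[OF _ conjunct2[OF timer_L] fading_LW pos(5) \<theta>(2) d(2) t]
          by (simp add: Z_def sense_def)
      qed
      ultimately show ?thesis
        by (simp add: prod_L Q_def)
    qed
    finally show ?thesis .
  qed
  have "(\<integral>\<omega>. H (tW i \<omega>, B \<omega>) \<partial>M) = (\<integral>\<omega>'. \<integral>\<omega>. H (tW i \<omega>', B \<omega>) \<partial>M \<partial>M)"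
    by (rule integral_decouple_blocks[OF indep_evs Int_stable_evs _ _ B_src H_meas H_bound, where I = "{TimerW i}"])
      (use measurable_mark_src[of "TimerW i" "{TimerW i}"] in auto)
  also have "\<dots> = (\<integral>t. \<integral>\<omega>. H (t, B \<omega>) \<partial>M \<partial>distr M borel (tW i))"
    by (subst integral_distr) auto
  also have "\<dots> = (\<integral>t. Q t \<partial>unit_uniform)"
  proof -
    have "(\<lambda>t. \<integral>\<omega>. H (t, B \<omega>) \<partial>M) \<in> borel_measurable borel" "Q \<in> borel_measurable borel"
      unfolding Q_def by measurable
    moreover have "AE t in unit_uniform. (\<integral>\<omega>. H (t, B \<omega>) \<partial>M) = Q t"
      using inner by (intro AE_uniform_measureI) auto
    ultimately show ?thesis
      unfolding conjunct2[OF timer_W] by (intro integral_cong_AE) auto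
  qed
  also have "(\<integral>\<omega>. H (tW i \<omega>, B \<omega>) \<partial>M) =
      (\<integral>\<omega>. (\<Prod>j\<in>J. access_factor (tW j \<omega>) (tW i \<omega>) (GW j i \<omega>) (d j) \<theta>1) *
      (\<Prod>m\<in>J'. access_factor (tL m \<omega>) (tW i \<omega>) (GLW m i \<omega>) (e m) \<theta>2) \<partial>M)"
    using J(3) unfolding H_def B_def
    by (intro Bochner_Integration.integral_cong refl)
      (auto intro!: arg_cong2[where f = "(*)"] prod.cong)
  finally show ?thesis
    unfolding Q_def .
qed

text \<open>Partial products converge on both sides under the bound 1. On the right this uses
  \<open>t\<close> in [0,1], which holds almost surely under the uniform law.\<close>

lemma expectation_access_given_points:
  assumes \<theta>: "\<theta>1 > 0" "\<theta>2 > 0" and d: "\<And>j. d j \<ge> 0" "\<And>m. e m \<ge> 0"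
  shows "(\<integral>\<omega>. index_prod (UNIV - {i}) (\<lambda>j. access_factor (tW j \<omega>) (tW i \<omega>) (GW j i \<omega>) (d j) \<theta>1) *
      index_prod UNIV (\<lambda>m. access_factor (tL m \<omega>) (tW i \<omega>) (GLW m i \<omega>) (e m) \<theta>2) \<partial>M) =
    (\<integral>t. index_prod (UNIV - {i}) (\<lambda>j. 1 - t * sense \<theta>1 (d j)) *
      index_prod UNIV (\<lambda>m. 1 - t * sense \<theta>2 (e m)) \<partial>unit_uniform)"
proof -
  interpret U: prob_space unit_uniform
    by (rule prob_space_unit_uniform)
  let ?a = "\<lambda>j \<omega>. access_factor (tW j \<omega>) (tW i \<omega>) (GW j i \<omega>) (d j) \<theta>1"
  let ?b = "\<lambda>m \<omega>. access_factor (tL m \<omega>) (tW i \<omega>) (GLW m i \<omega>) (e m) \<theta>2"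
  let ?J = "\<lambda>n. (UNIV - {i}) \<inter> {..<n}"
  let ?J' = "\<lambda>n. UNIV \<inter> {..<n} :: nat set"
  have factors: "1 - t * sense \<theta>1 (d j) \<in> {0..1}" "1 - t * sense \<theta>2 (e m) \<in> {0..1}" if "t \<in> {0..1}" for t j m
    using mult_sense_01[OF \<theta>(1) d(1)[of j] that] mult_sense_01[OF \<theta>(2) d(2)[of m] that] by auto
  have prod_bound: "norm ((\<Prod>j\<in>A. f j) * (\<Prod>m\<in>B. g m)) \<le> 1"
    if "\<And>j. f j \<in> {0..1}" "\<And>m. g m \<in> {0..1}" for A B and f g :: "nat \<Rightarrow> real"
    using that by (auto simp: abs_mult abs_prod intro!: mult_le_one prod_le_1 prod_nonneg)
  have "(\<lambda>n. \<integral>\<omega>. (\<Prod>j\<in>?J n. ?a j \<omega>) * (\<Prod>m\<in>?J' n. ?b m \<omega>) \<partial>M) \<longlonglongrightarrow>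
      (\<integral>\<omega>. index_prod (UNIV - {i}) (\<lambda>j. ?a j \<omega>) * index_prod UNIV (\<lambda>m. ?b m \<omega>) \<partial>M)"
  proof (rule integral_dominated_convergence[where w = "\<lambda>_. 1"])
    show "AE \<omega> in M. (\<lambda>n. (\<Prod>j\<in>?J n. ?a j \<omega>) * (\<Prod>m\<in>?J' n. ?b m \<omega>)) \<longlonglongrightarrow>
        index_prod (UNIV - {i}) (\<lambda>j. ?a j \<omega>) * index_prod UNIV (\<lambda>m. ?b m \<omega>)"
      by (intro AE_I2 tendsto_mult index_prod_tendsto access_factor_01)
    show "AE \<omega> in M. norm ((\<Prod>j\<in>?J n. ?a j \<omega>) * (\<Prod>m\<in>?J' n. ?b m \<omega>)) \<le> 1" for n
      by (intro AE_I2 prod_bound access_factor_01)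
  qed auto
  moreover have "(\<integral>\<omega>. (\<Prod>j\<in>?J n. ?a j \<omega>) * (\<Prod>m\<in>?J' n. ?b m \<omega>) \<partial>M) =
      (\<integral>t. (\<Prod>j\<in>?J n. 1 - t * sense \<theta>1 (d j)) * (\<Prod>m\<in>?J' n. 1 - t * sense \<theta>2 (e m)) \<partial>unit_uniform)" for n
    by (rule expectation_finite_product[OF \<theta> d]) auto
  moreover have "(\<lambda>n. \<integral>t. (\<Prod>j\<in>?J n. 1 - t * sense \<theta>1 (d j)) * (\<Prod>m\<in>?J' n. 1 - t * sense \<theta>2 (e m)) \<partial>unit_uniform) \<longlonglongrightarrow>
      (\<integral>t. index_prod (UNIV - {i}) (\<lambda>j. 1 - t * sense \<theta>1 (d j)) *
        index_prod UNIV (\<lambda>m. 1 - t * sense \<theta>2 (e m)) \<partial>unit_uniform)"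
  proof (rule integral_dominated_convergence[where w = "\<lambda>_. 1"])
    show "AE t in unit_uniform. (\<lambda>n. (\<Prod>j\<in>?J n. 1 - t * sense \<theta>1 (d j)) * (\<Prod>m\<in>?J' n. 1 - t * sense \<theta>2 (e m))) \<longlonglongrightarrow>
        index_prod (UNIV - {i}) (\<lambda>j. 1 - t * sense \<theta>1 (d j)) * index_prod UNIV (\<lambda>m. 1 - t * sense \<theta>2 (e m))"
      using factors by (intro AE_uniform_measureI AE_I2 impI tendsto_mult index_prod_tendsto) auto
    show "AE t in unit_uniform. norm ((\<Prod>j\<in>?J n. 1 - t * sense \<theta>1 (d j)) * (\<Prod>m\<in>?J' n. 1 - t * sense \<theta>2 (e m))) \<le> 1" for n
      using factors by (intro AE_uniform_measureI AE_I2 impI prod_bound) auto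
  qed auto
  ultimately show ?thesis
    using LIMSEQ_unique by simp
qed

section \<open>Contention functionals as integrals of the sensing probability\<close>

abbreviation "l \<equiv> path_loss lamc \<alpha>"

abbreviation p :: "real \<Rightarrow> real^2 \<Rightarrow> real" where
  "p \<theta> z \<equiv> sense \<theta> (l (norm z))"

lemma l_nonneg: "l (norm z) \<ge> 0"
  by (simp add: path_loss_def)

lemma p_eq_exp: "z \<noteq> 0 \<Longrightarrow> p \<theta> z = exp (- (\<mu> * \<theta> * l (norm z)))"
  using path_loss_pos[of lamc "norm z" \<alpha>] pos by (simp add: sense_def)

lemma measurable_sense [measurable]: "sense \<theta> \<in> borel_measurable borel"
  unfolding sense_def[abs_def] by measurable

lemma exp_path_loss_integrable:
  assumes "\<theta> > 0"
  shows "integrable lborel (\<lambda>z::real^2. exp (- (\<mu> * \<theta> * l (norm z))))"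
proof -
  have "integrable lborel (\<lambda>z::real^2. exp (- (\<mu> * \<theta> * (4 * pi / lamc)\<^sup>2 * norm z powr \<alpha>)))"
    using assms pos by (intro integrable_exp_minus_powr_plane) auto
  then show ?thesis
    by (simp add: path_loss_def mult.assoc)
qed

lemma AE_p_eq_exp: "AE z in lborel. p \<theta> z = exp (- (\<mu> * \<theta> * l (norm z)))"
proof -
  have "AE z in lborel. z \<noteq> (0 :: real^2)"
    by (rule AE_lborel_singleton)
  then show ?thesis
    by eventually_elim (simp add: p_eq_exp)
qed

lemma p_integrable:
  assumes "\<theta> > 0"
  shows "integrable lborel (p \<theta>)"
proof -
  have "integrable lborel (p \<theta>) \<longleftrightarrow> integrable lborel (\<lambda>z::real^2. exp (- (\<mu> * \<theta> * l (norm z))))"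
    by (intro integrable_cong_AE AE_p_eq_exp) auto
  then show ?thesis
    using exp_path_loss_integrable[OF assms] by simp
qed

lemma p_cont: "z \<noteq> 0 \<Longrightarrow> isCont (p \<theta>) z"
proof -
  assume "z \<noteq> 0"
  have "continuous_on (- {0}) (p \<theta>) \<longleftrightarrow> continuous_on (- {0}) (\<lambda>z::real^2. exp (- (\<mu> * \<theta> * l (norm z))))"
    by (intro continuous_on_cong refl) (simp add: p_eq_exp)
  moreover have "continuous_on (- {0}) (\<lambda>z::real^2. exp (- (\<mu> * \<theta> * l (norm z))))"
    unfolding path_loss_def by (intro continuous_intros) auto
  ultimately show ?thesis
    using \<open>z \<noteq> 0\<close> by (simp add: continuous_on_eq_continuous_at open_Compl)
qed

lemma p_01: "\<theta> > 0 \<Longrightarrow> t \<in> {0..1} \<Longrightarrow> t * p \<theta> z \<in> {0..1}"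
  by (intro mult_sense_01 l_nonneg)

lemma NL_eq: "NL lamL \<mu> l P \<Gamma> = lamL * (\<integral>z. p (\<Gamma> / P) z \<partial>lborel)"
  unfolding NL_def using AE_p_eq_exp[of "\<Gamma> / P"] by (intro arg_cong[where f = "(*) lamL"] integral_cong_AE) auto

text \<open>A strictly positive function has positive integral over the plane. This makes the
  denominator of the access probability positive at every distance.\<close>

lemma NL_pos:
  assumes "\<Gamma> > 0" "P > 0"
  shows "NL lamL \<mu> l P \<Gamma> > 0"
proof -
  let ?f = "\<lambda>z::real^2. exp (- (\<mu> * (\<Gamma> / P) * l (norm z)))"
  have int: "integrable lborel ?f"
    using assms by (intro exp_path_loss_integrable) simp
  have "(\<integral>z. ?f z \<partial>lborel) \<noteq> 0"
  proof
    assume "(\<integral>z. ?f z \<partial>lborel) = 0"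
    then have "AE z in lborel. ?f z = 0"
      using int by (subst (asm) integral_nonneg_eq_0_iff_AE) auto
    then have "AE z in (lborel :: (real^2) measure). False"
      by simp
    then have "emeasure lborel (UNIV :: (real^2) set) = 0"
      by (subst (asm) AE_iff_measurable[OF _ refl]) auto
    then show False
      by simp
  qed
  then have "0 < (\<integral>z. ?f z \<partial>lborel)"
    using Bochner_Integration.integral_nonneg[of lborel ?f] by (simp add: order_less_le)
  then show ?thesis
    using pos by (simp add: NL_def)
qed

lemma N2W_nonneg: "N2W lamW \<mu> l P \<Gamma> r \<ge> 0"
  unfolding N2W_def set_lebesgue_integral_def using pos
  by (intro mult_nonneg_nonneg Bochner_Integration.integral_nonneg) auto

lemma measurable_N2W [measurable]: "N2W lamW \<mu> l P \<Gamma> \<in> borel_measurable borel"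
proof -
  have "(\<lambda>r. \<integral>x. (if norm (x :: real^2) \<le> r then 0 else
      exp (- (\<mu> * (\<Gamma> / P) * l (norm (x - r *\<^sub>R axis 1 1))))) \<partial>lborel) \<in> borel_measurable borel"
  proof (rule lborel.borel_measurable_lebesgue_integral)
    show "(\<lambda>(r, x). if norm (x :: real^2) \<le> r then 0 else
        exp (- (\<mu> * (\<Gamma> / P) * l (norm (x - r *\<^sub>R axis 1 1))))) \<in> borel_measurable (borel \<Otimes>\<^sub>M lborel)"
      by measurable
  qed
  moreover have "N2W lamW \<mu> l P \<Gamma> r = lamW * (\<integral>x. (if norm (x :: real^2) \<le> r then 0 else
      exp (- (\<mu> * (\<Gamma> / P) * l (norm (x - r *\<^sub>R axis 1 1))))) \<partial>lborel)" for r
    unfolding N2W_def set_lebesgue_integral_def vector_axis_2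
    by (intro arg_cong[where f = "(*) lamW"] Bochner_Integration.integral_cong) (auto simp: indicator_def)
  ultimately show ?thesis
    by (simp add: borel_measurable_times cong: measurable_cong)
qed

lemma N2W_norm_eq:
  "lamW * (LINT y : UNIV - cball 0 (norm x) | lborel. p (\<Gamma> / P) (y - x)) = N2W lamW \<mu> l P \<Gamma> (norm x)"
proof -
  have "(LINT y : UNIV - cball 0 (norm x) | lborel. p (\<Gamma> / P) (y - x)) =
      (LINT y : UNIV - cball 0 (norm x) | lborel. exp (- (\<mu> * (\<Gamma> / P) * l (norm (y - x)))))"
    unfolding set_lebesgue_integral_def
  proof (rule Bochner_Integration.integral_cong[OF refl])
    show "indicator (UNIV - cball 0 (norm x)) y *\<^sub>R p (\<Gamma> / P) (y - x) =
        indicator (UNIV - cball 0 (norm x)) y *\<^sub>R exp (- (\<mu> * (\<Gamma> / P) * l (norm (y - x))))" for y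
      \<comment> \<open>The two functions differ at \<open>y = x\<close>, but \<open>x\<close> lies
        in the removed closed ball.\<close>
      by (cases "y = x") (simp_all add: p_eq_exp)
  qed
  also have "\<dots> = (LINT y : UNIV - cball 0 (norm x) | lborel.
      exp (- (\<mu> * (\<Gamma> / P) * l (norm (y - (vector [norm x, 0] :: real^2))))))"
    by (rule outer_integral_rotation[of "\<lambda>d. exp (- (\<mu> * (\<Gamma> / P) * l d))"]) measurable
  finally show ?thesis
    by (simp add: N2W_def)
qed

lemma closest_distance_density_integrable:
  "set_integrable lborel {0<..} (closest_distance_density lamW)"
  "integrable lborel (\<lambda>x::real^2. exp (- (lamW * measure lborel (cball (0::real^2) (norm x)))))"
proof -
  have "integrable lborel (\<lambda>x::real^2. exp (- (lamW * pi * norm x powr 2)))"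
    using pos by (intro integrable_exp_minus_powr_plane) auto
  then have *: "integrable lborel (\<lambda>x::real^2. exp (- (lamW * pi * (norm x)\<^sup>2)))"
    by (simp add: powr_numeral)
  then show "integrable lborel (\<lambda>x::real^2. exp (- (lamW * measure lborel (cball (0::real^2) (norm x)))))"
    by (simp add: measure_cball_plane mult.assoc)
  have "set_integrable lborel {0<..} (\<lambda>r. 2 * pi * r * exp (- (lamW * pi * r\<^sup>2)))"
    using * by (subst (asm) integrable_radial_plane[of "\<lambda>r. exp (- (lamW * pi * r\<^sup>2))"]) auto
  then have "set_integrable lborel {0<..} (\<lambda>r. lamW * (2 * pi * r * exp (- (lamW * pi * r\<^sup>2))))"
    by (rule set_integrable_mult_right)
  then show "set_integrable lborel {0<..} (closest_distance_density lamW)"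
    by (simp add: closest_distance_density_def[abs_def] ac_simps)
qed

text \<open>With \<open>X\<close> frozen the tagged position is a constant \<open>c\<close>, and the
  mean of the product over \<open>Y\<close> is the same for every \<open>c\<close>. It factors out,
  and the closest-point formula is applied to \<open>X\<close> alone.\<close>

lemma expectation_access_given_timer:
  assumes t: "t \<in> {0..1}" and \<Gamma>: "\<Gamma>1 > 0" "\<Gamma>2 > 0" and P: "P1 > 0" "P2 > 0"
  shows "(\<integral>\<omega>. index_prod (UNIV - {closest X \<omega>}) (\<lambda>j. 1 - t * p (\<Gamma>1 / P1) (X j \<omega> - X (closest X \<omega>) \<omega>)) *
      index_prod UNIV (\<lambda>m. 1 - t * p (\<Gamma>2 / P2) (Y m \<omega> - X (closest X \<omega>) \<omega>)) \<partial>M) =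
    (LINT r : {0<..} | lborel. closest_distance_density lamW r *
      exp (- (t * (N2W lamW \<mu> l P1 \<Gamma>1 r + NL lamL \<mu> l P2 \<Gamma>2))))"
proof -
  let ?\<theta>1 = "\<Gamma>1 / P1" and ?\<theta>2 = "\<Gamma>2 / P2"
  have \<theta>: "?\<theta>1 > 0" "?\<theta>2 > 0"
    using \<Gamma> P by simp_all
  let ?PM = "Pi\<^sub>M UNIV (\<lambda>_. borel) :: (nat \<Rightarrow> real^2) measure"
  define a where "a i x = index_prod (UNIV - {i}) (\<lambda>j. 1 - t * p ?\<theta>1 (x j - x i))" for i and x :: "nat \<Rightarrow> real^2"
  define b where "b c y = index_prod UNIV (\<lambda>m. 1 - t * p ?\<theta>2 (y m - c))" for c :: "real^2" and y :: "nat \<Rightarrow> real^2"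
  \<comment> \<open>The tagged index as a measurable function of the whole point sequence, so that
    it is frozen together with it.\<close>
  define k where "k x = closest (\<lambda>j x. x j) x" for x :: "nat \<Rightarrow> real^2"
  have k [measurable]: "k \<in> ?PM \<rightarrow>\<^sub>M count_space UNIV"
    unfolding k_def by measurable
  have k_X: "k (\<lambda>i. X i \<omega>) = closest X \<omega>" for \<omega>
    by (simp add: k_def closest_def)
  define H where "H q = a (k (fst q)) (fst q) * b (fst q (k (fst q))) (snd q)" for q
  have H_meas: "H \<in> borel_measurable (?PM \<Otimes>\<^sub>M ?PM)"
    unfolding H_def
  proof (rule measurable_compose_countable)
    show "(\<lambda>q. a i (fst q) * b (fst q i) (snd q)) \<in> borel_measurable (?PM \<Otimes>\<^sub>M ?PM)" for i
      unfolding a_def b_def by measurable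
  qed measurable
  have ab: "a i x \<in> {0..1}" "b c x \<in> {0..1}" for i x c
    unfolding a_def b_def using p_01[OF \<theta>(1) t] p_01[OF \<theta>(2) t] by (intro index_prod_bounds; simp)+
  have H_bound: "\<bar>H q\<bar> \<le> 1" for q
    unfolding H_def using ab by (auto simp: abs_mult intro!: mult_le_one)
  have b_mean: "(\<integral>\<omega>. b c (\<lambda>i. Y i \<omega>) \<partial>M) = exp (- (t * NL lamL \<mu> l P2 \<Gamma>2))" for c
  proof -
    have int: "integrable (distr lborel borel ((+) (- c))) (p ?\<theta>2)"
      using p_integrable[OF \<theta>(2)] by (simp add: lborel_distr_plus)
    then have "integrable lborel (\<lambda>y. t * p ?\<theta>2 (y - c))"
      by (subst (asm) integrable_distr_eq) auto
    then have "(\<integral>\<omega>. b c (\<lambda>i. Y i \<omega>) \<partial>M) = exp (- (lamL * (\<integral>y. t * p ?\<theta>2 (y - c) \<partial>lborel)))"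
      unfolding b_def using p_01[OF \<theta>(2) t] by (intro L.generating_functional)
    also have "(\<integral>y. t * p ?\<theta>2 (y - c) \<partial>lborel) = t * (\<integral>y. p ?\<theta>2 y \<partial>distr lborel borel ((+) (- c)))"
      by (subst integral_distr) auto
    finally show ?thesis
      by (simp add: lborel_distr_plus NL_eq ac_simps)
  qed
  have "(\<integral>\<omega>. H (\<lambda>i. X i \<omega>, \<lambda>k. Y k \<omega>) \<partial>M) = (\<integral>\<omega>'. \<integral>\<omega>. H (\<lambda>i. X i \<omega>', \<lambda>k. Y k \<omega>) \<partial>M \<partial>M)"
  proof (rule integral_decouple_blocks[OF indep_evs Int_stable_evs _ _ _ H_meas H_bound])
    show "(\<lambda>\<omega> i. X i \<omega>) \<in> src {PointsW} \<rightarrow>\<^sub>M ?PM" "(\<lambda>\<omega> k. Y k \<omega>) \<in> src {PointsL} \<rightarrow>\<^sub>M ?PM"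
      by (rule measurable_points_src; simp)+
  qed simp
  also have "\<dots> = (\<integral>\<omega>'. a (closest X \<omega>') (\<lambda>i. X i \<omega>') \<partial>M) * exp (- (t * NL lamL \<mu> l P2 \<Gamma>2))"
    by (simp add: H_def k_X b_mean)
  also have "(\<integral>\<omega>'. a (closest X \<omega>') (\<lambda>i. X i \<omega>') \<partial>M) =
    lamW * (\<integral>x. exp (- (lamW * measure lborel (cball (0::real^2) (norm x)))) *
      exp (- (lamW * (LINT y : UNIV - cball 0 (norm x) | lborel. t * p ?\<theta>1 (y - x)))) \<partial>lborel)"
    unfolding a_def
    using p_integrable[OF \<theta>(1)] p_01[OF \<theta>(1) t] p_cont closest_distance_density_integrable(2)
    by (intro W.closest_point_formula[of "\<lambda>z. t * p ?\<theta>1 z"] continuous_intros) auto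
  also have "\<dots> = lamW * (\<integral>x. exp (- (lamW * (pi * (norm (x :: real^2))\<^sup>2))) * exp (- (t * N2W lamW \<mu> l P1 \<Gamma>1 (norm x))) \<partial>lborel)"
    by (simp add: measure_cball_plane N2W_norm_eq[symmetric] ac_simps)
  \<comment> \<open>The Jacobian \<open>2 * pi * r\<close>, the factor \<open>lamW\<close> and the
    void probability together form \<open>closest_distance_density\<close>.\<close>
  also have "\<dots> = lamW * (LINT r : {0<..} | lborel. 2 * pi * r * (exp (- (lamW * (pi * r\<^sup>2))) * exp (- (t * N2W lamW \<mu> l P1 \<Gamma>1 r))))"
    by (subst integral_radial_plane[of "\<lambda>r. exp (- (lamW * (pi * r\<^sup>2))) * exp (- (t * N2W lamW \<mu> l P1 \<Gamma>1 r))"]) auto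
  also have "\<dots> * exp (- (t * NL lamL \<mu> l P2 \<Gamma>2)) = (LINT r : {0<..} | lborel. closest_distance_density lamW r *
      exp (- (t * (N2W lamW \<mu> l P1 \<Gamma>1 r + NL lamL \<mu> l P2 \<Gamma>2))))"
  proof -
    have "exp (- (t * (u + v))) = exp (- (t * u)) * exp (- (t * v))" for u v
      by (simp add: exp_add[symmetric] algebra_simps)
    then show ?thesis
      by (simp add: closest_distance_density_def set_integral_mult_right[symmetric] set_integral_mult_left[symmetric]
        ac_simps del: set_integral_mult_right set_integral_mult_left)
  qed
  finally show ?thesis
    by (simp add: H_def k_X a_def b_def)
qed

text \<open>Averaging over the marks leaves a uniform \<open>t\<close>. It is moved outside the
  points, where \<open>expectation_access_given_timer\<close> applies, and then inside the distance
  integral, where \<open>exp (- (t * N r))\<close> averages to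
  \<open>(1 - exp (- N r)) / N r\<close>.\<close>

lemma expectation_access_closest:
  assumes \<Gamma>: "\<Gamma>1 > 0" "\<Gamma>2 > 0" and P: "P1 > 0" "P2 > 0"
  defines "N \<equiv> \<lambda>r. N2W lamW \<mu> l P1 \<Gamma>1 r + NL lamL \<mu> l P2 \<Gamma>2"
  shows "(\<integral>\<omega>. access_W X Y tW tL GW GLW l P1 P2 \<Gamma>1 \<Gamma>2 (closest X \<omega>) \<omega> \<partial>M) =
    (LINT r : {0<..} | lborel. (1 - exp (- N r)) / N r * closest_distance_density lamW r)"
proof -
  interpret U: prob_space unit_uniform
    by (rule prob_space_unit_uniform)
  let ?\<theta>1 = "\<Gamma>1 / P1" and ?\<theta>2 = "\<Gamma>2 / P2"
  have \<theta>: "?\<theta>1 > 0" "?\<theta>2 > 0"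
    using \<Gamma> P by simp_all
  let ?PM = "Pi\<^sub>M UNIV (\<lambda>_. borel) :: (nat \<Rightarrow> real^2) measure"
  let ?PS = "Pi\<^sub>M UNIV (\<lambda>_. borel) :: (source \<Rightarrow> real) measure"
  define k where "k x = closest (\<lambda>j x. x j) x" for x :: "nat \<Rightarrow> real^2"
  have k [measurable]: "k \<in> ?PM \<rightarrow>\<^sub>M count_space UNIV"
    unfolding k_def by measurable
  have k_X: "k (\<lambda>i. X i \<omega>) = closest X \<omega>" for \<omega>
    by (simp add: k_def closest_def)
  define F where "F i x y b =
    index_prod (UNIV - {i}) (\<lambda>j. access_factor (b (TimerW j)) (b (TimerW i)) (b (FadingW j i)) (l (norm (x j - x i))) ?\<theta>1) *
    index_prod UNIV (\<lambda>m. access_factor (b (TimerL m)) (b (TimerW i)) (b (FadingLW m i)) (l (norm (y m - x i))) ?\<theta>2)"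
    for i and x y :: "nat \<Rightarrow> real^2" and b :: "source \<Rightarrow> real"
  define H where "H q = F (k (fst (fst q))) (fst (fst q)) (snd (fst q)) (snd q)" for q
  have H_meas: "H \<in> borel_measurable ((?PM \<Otimes>\<^sub>M ?PM) \<Otimes>\<^sub>M ?PS)"
    unfolding H_def
  proof (rule measurable_compose_countable)
    show "(\<lambda>q. F i (fst (fst q)) (snd (fst q)) (snd q)) \<in> borel_measurable ((?PM \<Otimes>\<^sub>M ?PM) \<Otimes>\<^sub>M ?PS)" for i
      unfolding F_def by measurable
  qed measurable
  have H_bound: "\<bar>H q\<bar> \<le> 1" for q
  proof -
    have "index_prod I (\<lambda>j. access_factor (s j) t (g j) (d j) \<theta>) \<in> {0..1}" for I s t g d \<theta>
      by (intro index_prod_bounds access_factor_01)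
    then show ?thesis
      unfolding H_def F_def by (auto simp: abs_mult intro!: mult_le_one)
  qed
  define Q where "Q t i x y = index_prod (UNIV - {i}) (\<lambda>j. 1 - t * p ?\<theta>1 (x j - x i)) *
    index_prod UNIV (\<lambda>m. 1 - t * p ?\<theta>2 (y m - x i))" for t i and x y :: "nat \<Rightarrow> real^2"
  \<comment> \<open>clamping makes the integrand bounded for all \<open>t\<close>, not just almost all\<close>
  define c where "c t = max 0 (min 1 t)" for t :: real
  have c: "c t \<in> {0..1}" "t \<in> {0..1} \<Longrightarrow> c t = t" for t
    by (auto simp: c_def)
  have c_meas [measurable]: "c \<in> borel_measurable borel"
    unfolding c_def by measurable
  have AE_c: "AE t in unit_uniform. c t = t"
    using c(2) by (intro AE_uniform_measureI) auto
  have "(\<integral>\<omega>. H ((\<lambda>i. X i \<omega>, \<lambda>k. Y k \<omega>), \<lambda>s. mark s \<omega>) \<partial>M) =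
      (\<integral>\<omega>'. \<integral>\<omega>. H ((\<lambda>i. X i \<omega>', \<lambda>k. Y k \<omega>'), \<lambda>s. mark s \<omega>) \<partial>M \<partial>M)"
  proof (rule integral_decouple_blocks[OF indep_evs Int_stable_evs _ _ _ H_meas H_bound,
        where I = "{PointsW, PointsL}" and J = "UNIV - {PointsW, PointsL}"])
    show "(\<lambda>\<omega>. (\<lambda>i. X i \<omega>, \<lambda>k. Y k \<omega>)) \<in> src {PointsW, PointsL} \<rightarrow>\<^sub>M ?PM \<Otimes>\<^sub>M ?PM"
      by (intro measurable_Pair measurable_points_src) auto
    show "(\<lambda>\<omega> s. mark s \<omega>) \<in> src (UNIV - {PointsW, PointsL}) \<rightarrow>\<^sub>M ?PS"
    proof (rule measurable_PiM_single')
      show "mark s \<in> borel_measurable (src (UNIV - {PointsW, PointsL}))" for s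
      proof (cases "s \<in> {PointsW, PointsL}")
        case True
        then show ?thesis
          by (auto simp: mark_def)
      qed (auto intro: measurable_mark_src)
    qed (simp add: space_PiM)
  qed auto
  also have "\<dots> = (\<integral>\<omega>. \<integral>t. Q t (closest X \<omega>) (\<lambda>i. X i \<omega>) (\<lambda>k. Y k \<omega>) \<partial>unit_uniform \<partial>M)"
    unfolding H_def F_def Q_def fst_conv snd_conv k_X mark_simps
    by (intro Bochner_Integration.integral_cong refl expectation_access_given_points \<theta> l_nonneg)
  also have "\<dots> = (\<integral>\<omega>. \<integral>t. Q (c t) (closest X \<omega>) (\<lambda>i. X i \<omega>) (\<lambda>k. Y k \<omega>) \<partial>unit_uniform \<partial>M)"
  proof -
    have "(\<integral>t. Q t i x y \<partial>unit_uniform) = (\<integral>t. Q (c t) i x y \<partial>unit_uniform)" for i x y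
    proof (rule integral_cong_AE)
      show "AE t in unit_uniform. Q t i x y = Q (c t) i x y"
        using AE_c by eventually_elim simp
    qed (simp_all add: Q_def)
    then show ?thesis
      by simp
  qed
  also have "\<dots> = (\<integral>t. \<integral>\<omega>. Q (c t) (closest X \<omega>) (\<lambda>i. X i \<omega>) (\<lambda>k. Y k \<omega>) \<partial>M \<partial>unit_uniform)"
  proof -
    let ?f = "\<lambda>q. Q (c (snd q)) (closest X (fst q)) (\<lambda>i. X i (fst q)) (\<lambda>k. Y k (fst q))"
    have "?f \<in> borel_measurable (M \<Otimes>\<^sub>M borel)"
    proof (rule measurable_compose_countable)
      show "(\<lambda>q. Q (c (snd q)) i (\<lambda>i. X i (fst q)) (\<lambda>k. Y k (fst q))) \<in> borel_measurable (M \<Otimes>\<^sub>M borel)" for i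
        unfolding Q_def by measurable
    qed (rule measurable_compose[OF measurable_fst measurable_closest[OF W.measurable_point]])
    then have "?f \<in> borel_measurable (M \<Otimes>\<^sub>M unit_uniform)"
      by (simp cong: measurable_cong_sets sets_pair_measure_cong)
    moreover have "\<bar>Q (c t) i x y\<bar> \<le> 1" for t i x y
    proof -
      have "index_prod (UNIV - {i}) (\<lambda>j. 1 - c t * p ?\<theta>1 (x j - x i)) \<in> {0..1}"
        "index_prod UNIV (\<lambda>m. 1 - c t * p ?\<theta>2 (y m - x i)) \<in> {0..1}"
        using p_01[OF \<theta>(1) c(1)] p_01[OF \<theta>(2) c(1)] by (intro index_prod_bounds; simp)+
      then show ?thesis
        unfolding Q_def by (auto simp: abs_mult intro!: mult_le_one)
    qed
    ultimately show ?thesis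
      using integral_Fubini_bounded(2)[OF finite_measure_axioms U.finite_measure_axioms, of ?f 1] by simp
  qed
  also have "\<dots> = (\<integral>t. (LINT r : {0<..} | lborel. closest_distance_density lamW r * exp (- (c t * N r))) \<partial>unit_uniform)"
    unfolding Q_def N_def by (simp only: expectation_access_given_timer[OF c(1) \<Gamma> P])
  also have "\<dots> = (LINT r : {0<..} | lborel. (1 - exp (- N r)) / N r * closest_distance_density lamW r)"
  proof -
    let ?h = "\<lambda>r. indicator {0<..} r * closest_distance_density lamW r"
    \<comment> \<open>The measure with the closest-distance density on the positive half-line; its
      finiteness admits the exchange with the integral over \<open>t\<close>.\<close>
    define \<nu> where "\<nu> = density lborel (\<lambda>r. ennreal (?h r))"
    have [measurable]: "closest_distance_density lamW \<in> borel_measurable borel"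
      unfolding closest_distance_density_def[abs_def] by measurable
    have [measurable]: "N \<in> borel_measurable borel"
      unfolding N_def by measurable
    have h_nonneg: "AE r in lborel. 0 \<le> ?h r"
      using pos by (auto simp: indicator_def closest_distance_density_def)
    have N_pos: "N r > 0" for r
      unfolding N_def using N2W_nonneg NL_pos[OF \<Gamma>(2) P(2)] by (rule add_nonneg_pos)
    have \<nu>_int: "(\<integral>r. g r \<partial>\<nu>) = (LINT r : {0<..} | lborel. closest_distance_density lamW r * g r)"
      if [measurable]: "g \<in> borel_measurable borel" for g :: "real \<Rightarrow> real"
      unfolding \<nu>_def using h_nonneg by (subst integral_real_density) (auto simp: set_lebesgue_integral_def mult.assoc)
    have "finite_measure \<nu>"
    proof
      have "integrable lborel ?h"
        using closest_distance_density_integrable(1) by (simp add: set_integrable_def)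
      then have "(\<integral>\<^sup>+r. ennreal (?h r) \<partial>lborel) < \<infinity>"
        using h_nonneg by (simp add: nn_integral_eq_integral)
      then show "emeasure \<nu> (space \<nu>) \<noteq> \<infinity>"
        unfolding \<nu>_def by (subst emeasure_density) (auto simp: less_top[symmetric])
    qed
    have "(\<integral>t. (LINT r : {0<..} | lborel. closest_distance_density lamW r * exp (- (c t * N r))) \<partial>unit_uniform) =
        (\<integral>t. \<integral>r. exp (- (c t * N r)) \<partial>\<nu> \<partial>unit_uniform)"
      by (simp add: \<nu>_int)
    also have "\<dots> = (\<integral>r. \<integral>t. exp (- (c t * N r)) \<partial>unit_uniform \<partial>\<nu>)"
    proof -
      let ?f = "\<lambda>q. exp (- (c (fst q) * N (snd q)))"
      have "?f \<in> borel_measurable (borel \<Otimes>\<^sub>M borel)"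
        by measurable
      then have "?f \<in> borel_measurable (unit_uniform \<Otimes>\<^sub>M \<nu>)"
        by (simp add: \<nu>_def cong: measurable_cong_sets sets_pair_measure_cong)
      moreover have "\<bar>?f q\<bar> \<le> 1" for q
        using c(1)[of "fst q"] N_pos[of "snd q"] by simp
      ultimately show ?thesis
        using integral_Fubini_bounded(2)[OF U.finite_measure_axioms \<open>finite_measure \<nu>\<close>, of ?f 1] by simp
    qed
    also have "(\<lambda>r. \<integral>t. exp (- (c t * N r)) \<partial>unit_uniform) = (\<lambda>r. (1 - exp (- N r)) / N r)"
    proof
      fix r
      have "(\<integral>t. exp (- (c t * N r)) \<partial>unit_uniform) = (\<integral>t. exp (- (t * N r)) \<partial>unit_uniform)"
        using AE_c by (intro integral_cong_AE) auto
      then show "(\<integral>t. exp (- (c t * N r)) \<partial>unit_uniform) = (1 - exp (- N r)) / N r"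
        using N_pos by (simp add: integral_unit_uniform_exp)
    qed
    also have "(\<integral>r. (1 - exp (- N r)) / N r \<partial>\<nu>) =
        (LINT r : {0<..} | lborel. (1 - exp (- N r)) / N r * closest_distance_density lamW r)"
      by (subst \<nu>_int) (simp_all add: mult.commute)
    finally show ?thesis .
  qed
  also have "(\<integral>\<omega>. H ((\<lambda>i. X i \<omega>, \<lambda>k. Y k \<omega>), \<lambda>s. mark s \<omega>) \<partial>M) =
      (\<integral>\<omega>. access_W X Y tW tL GW GLW l P1 P2 \<Gamma>1 \<Gamma>2 (closest X \<omega>) \<omega> \<partial>M)"
    by (simp add: H_def F_def k_X access_W_def)
  finally show ?thesis .
qed

end

section \<open>Interchanging the two networks\<close>

primrec swap_source :: "source \<Rightarrow> source" where
  "swap_source PointsW = PointsL"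
| "swap_source PointsL = PointsW"
| "swap_source (TimerW i) = TimerL i"
| "swap_source (TimerL k) = TimerW k"
| "swap_source (FadingW j i) = FadingL j i"
| "swap_source (FadingLW m i) = FadingWL m i"
| "swap_source (FadingWL j k) = FadingLW j k"
| "swap_source (FadingL m k) = FadingW m k"

lemma swap_source_involution [simp]: "swap_source (swap_source s) = s"
  by (cases s) simp_all

lemma (in prob_space) indep_sets_reindex:
  assumes "indep_sets E (f ` I)" "inj_on f I"
  shows "indep_sets (\<lambda>i. E (f i)) I"
proof (rule indep_setsI)
  show "E (f i) \<subseteq> events" if "i \<in> I" for i
    using assms(1) that unfolding indep_sets_def by blast
  fix A J assume J: "J \<noteq> {}" "J \<subseteq> I" "finite J" "\<forall>j\<in>J. A j \<in> E (f j)"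
  have inj: "inj_on f J"
    using assms(2) J(2) by (rule inj_on_subset)
  then have inv: "inv_into J f (f j) = j" if "j \<in> J" for j
    using that by simp
  have "prob (\<Inter>k\<in>f ` J. A (inv_into J f k)) = (\<Prod>k\<in>f ` J. prob (A (inv_into J f k)))"
    using J inv by (intro indep_setsD[OF assms(1)]) auto
  moreover have "(\<Inter>k\<in>f ` J. A (inv_into J f k)) = (\<Inter>j\<in>J. A j)"
    using inv by auto
  ultimately show "prob (\<Inter>j\<in>J. A j) = (\<Prod>j\<in>J. prob (A j))"
    using inv by (simp add: prod.reindex[OF inj])
qed

text \<open>Exchanging the arguments permutes the sources by the involution
  \<open>swap_source\<close>, and independence of a family is invariant under injective
  reindexing.\<close>

lemma (in prob_space) indep_source_events_swap:
  assumes "indep_sets (source_events M X Y tW tL GW GLW GWL GL) UNIV"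
  shows "indep_sets (source_events M Y X tL tW GL GWL GLW GW) UNIV"
proof -
  have "source_events M Y X tL tW GL GWL GLW GW =
      (\<lambda>s. source_events M X Y tW tL GW GLW GWL GL (swap_source s))"
  proof
    show "source_events M Y X tL tW GL GWL GLW GW s =
        source_events M X Y tW tL GW GLW GWL GL (swap_source s)" for s
      by (cases s) simp_all
  qed
  moreover have "inj swap_source"
    by (metis injI swap_source_involution)
  then have "indep_sets (\<lambda>s. source_events M X Y tW tL GW GLW GWL GL (swap_source s)) UNIV"
    by (rule indep_sets_reindex[OF indep_sets_mono_index[OF subset_UNIV assms]])
  ultimately show ?thesis
    by simp
qed

theorem corollary3:
  fixes M :: "'a measure"
    and X Y :: "nat \<Rightarrow> 'a \<Rightarrow> real^2"
    and tW tL :: "nat \<Rightarrow> 'a \<Rightarrow> real"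
    and GW GLW GWL GL :: "nat \<Rightarrow> nat \<Rightarrow> 'a \<Rightarrow> real"
    and lam\<^sub>W lam\<^sub>L P\<^sub>W P\<^sub>L lam\<^sub>c \<alpha> \<Gamma>\<^sub>c\<^sub>s \<Gamma>\<^sub>e\<^sub>d \<Gamma>\<^sub>L \<mu> :: real
  assumes "prob_space M"
    and "lam\<^sub>W > 0" "lam\<^sub>L > 0" "P\<^sub>W > 0" "P\<^sub>L > 0" "lam\<^sub>c > 0" "\<alpha> > 0"
    and "\<Gamma>\<^sub>c\<^sub>s > 0" "\<Gamma>\<^sub>e\<^sub>d > 0" "\<Gamma>\<^sub>L > 0" "\<mu> > 0"
    and "homogeneous_poisson_process M lam\<^sub>W X"
    and "homogeneous_poisson_process M lam\<^sub>L Y"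
    and "\<And>i. tW i \<in> borel_measurable M \<and> distr M borel (tW i) = uniform_measure lborel {0..1}"
    and "\<And>k. tL k \<in> borel_measurable M \<and> distr M borel (tL k) = uniform_measure lborel {0..1}"
    and "\<And>j i. distributed M lborel (GW j i) (exponential_density \<mu>)"
    and "\<And>m i. distributed M lborel (GLW m i) (exponential_density \<mu>)"
    and "\<And>j k. distributed M lborel (GWL j k) (exponential_density \<mu>)"
    and "\<And>m k. distributed M lborel (GL m k) (exponential_density \<mu>)"
    and "prob_space.indep_sets M (source_events M X Y tW tL GW GLW GWL GL) UNIV"
  shows
    "(\<integral>\<omega>. access_W X Y tW tL GW GLW (path_loss lam\<^sub>c \<alpha>) P\<^sub>W P\<^sub>L \<Gamma>\<^sub>c\<^sub>s \<Gamma>\<^sub>e\<^sub>d (closest X \<omega>) \<omega> \<partial>M) =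
       (LINT r : {0<..} | lborel.
          (1 - exp (- N2W lam\<^sub>W \<mu> (path_loss lam\<^sub>c \<alpha>) P\<^sub>W \<Gamma>\<^sub>c\<^sub>s r - NL lam\<^sub>L \<mu> (path_loss lam\<^sub>c \<alpha>) P\<^sub>L \<Gamma>\<^sub>e\<^sub>d)) /
          (N2W lam\<^sub>W \<mu> (path_loss lam\<^sub>c \<alpha>) P\<^sub>W \<Gamma>\<^sub>c\<^sub>s r + NL lam\<^sub>L \<mu> (path_loss lam\<^sub>c \<alpha>) P\<^sub>L \<Gamma>\<^sub>e\<^sub>d) *
          closest_distance_density lam\<^sub>W r) \<and>
     (\<integral>\<omega>. access_L X Y tW tL GWL GL (path_loss lam\<^sub>c \<alpha>) P\<^sub>W P\<^sub>L \<Gamma>\<^sub>L (closest Y \<omega>) \<omega> \<partial>M) =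
       (LINT r : {0<..} | lborel.
          (1 - exp (- N3W lam\<^sub>W \<mu> (path_loss lam\<^sub>c \<alpha>) P\<^sub>W \<Gamma>\<^sub>L - N1L lam\<^sub>L \<mu> (path_loss lam\<^sub>c \<alpha>) P\<^sub>L r \<Gamma>\<^sub>L)) /
          (N3W lam\<^sub>W \<mu> (path_loss lam\<^sub>c \<alpha>) P\<^sub>W \<Gamma>\<^sub>L + N1L lam\<^sub>L \<mu> (path_loss lam\<^sub>c \<alpha>) P\<^sub>L r \<Gamma>\<^sub>L) *
          closest_distance_density lam\<^sub>L r)"
proof -
  interpret prob_space M by fact
  interpret W: contention M X Y tW tL GW GLW GWL GL lam\<^sub>W lam\<^sub>L lam\<^sub>c \<alpha> \<mu>
    by unfold_locales (use assms in auto)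
  interpret L: contention M Y X tL tW GL GWL GLW GW lam\<^sub>L lam\<^sub>W lam\<^sub>c \<alpha> \<mu>
    by unfold_locales (use assms indep_source_events_swap[OF assms(20)] in auto)
  \<comment> \<open>An eNB applies one threshold to both networks, so it fills both threshold
    arguments of \<open>access_W\<close>.\<close>
  have access: "access_L X Y tW tL GWL GL (path_loss lam\<^sub>c \<alpha>) P\<^sub>W P\<^sub>L \<Gamma>\<^sub>L k \<omega> =
      access_W Y X tL tW GL GWL (path_loss lam\<^sub>c \<alpha>) P\<^sub>L P\<^sub>W \<Gamma>\<^sub>L \<Gamma>\<^sub>L k \<omega>" for k \<omega>
    by (simp add: access_L_def access_W_def)
  have N3: "N3W lam\<^sub>W \<mu> (path_loss lam\<^sub>c \<alpha>) P\<^sub>W \<Gamma>\<^sub>L = NL lam\<^sub>W \<mu> (path_loss lam\<^sub>c \<alpha>) P\<^sub>W \<Gamma>\<^sub>L"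
    by (simp add: N3W_def NL_def)
  have N1: "N1L lam\<^sub>L \<mu> (path_loss lam\<^sub>c \<alpha>) P\<^sub>L r \<Gamma>\<^sub>L = N2W lam\<^sub>L \<mu> (path_loss lam\<^sub>c \<alpha>) P\<^sub>L \<Gamma>\<^sub>L r" for r
    by (simp add: N1L_def N2W_def)
  have neg: "- u - v = - (u + v)" "NL lam\<^sub>W \<mu> (path_loss lam\<^sub>c \<alpha>) P\<^sub>W \<Gamma>\<^sub>L + u = u + NL lam\<^sub>W \<mu> (path_loss lam\<^sub>c \<alpha>) P\<^sub>W \<Gamma>\<^sub>L"
    for u v :: real
    by simp_all
  show ?thesis
    unfolding access N3 N1 neg
    using assms(4,5,8-10) by (intro conjI W.expectation_access_closest L.expectation_access_closest)
qed

end
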